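(* Let $E$ be a sequential effect space and let $a\in E$. Then $a$ can be written as the supremum and norm limit of an increasing sequence of effects of the form $\sum_i\lambda_i p_i$ (finite sums), where $\lambda_i>0$ and the $p_i$ are orthogonal sharp effects that commute with $a$.
   Context: Effect algebra: a set $E$ with elements $0,1$ and a partially defined operation $+$ that is commutative and associative (where defined: if $x+y$ is defined so is $y+x$ and they are equal; if $y+z$ and $x+(y+z)$ are defined then so are $x+y$ and $(x+y)+z$, and $x+(y+z)=(x+y)+z$), with $x+0=x$ always defined, such that $x+1$ defined implies $x=0$, and such that each $x$ has a unique $x^\perp$ with $x+x^\perp=1$. It is partially ordered by $x\leq y\iff\exists z: x+z=y$. Elements of $E$ are called effects. Sequential effect algebra (SEA): an effect algebra with a total binary operation $\circ$ (the sequential product) such that, writing $a\mid b$ ("$a$ and $b$ commute") for $a\circ b=b\circ a$: (1) $a\circ(b+c)=a\circ b+a\circ c$ whenever $b+c$ is defined; (2) $1\circ a=a$; (3) $a\circ b=0\Rightarrow b\circ a=0$ (in this case $a,b$ are called orthogonal); (4) if $a\mid b$ then $a\mid b^\perp$ and $a\circ(b\circ c)=(a\circ b)\circ c$ for all $c$; (5) if $c\mid a$ and $c\mid b$ then $c\mid(a\circ b)$ and, if $a+b$ is defined, $c\mid(a+b)$. $\sigma$-SEA: a SEA in which every descending sequence $a_1\geq a_2\geq\cdots$ has an infimum $\bigwedge a_i$, with $b\circ\bigwedge a_i=\bigwedge(b\circ a_i)$, and $b\mid a_i$ for all $i$ implies $b\mid\bigwedge a_i$. Convex effect algebra: an effect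 algebra with an action $[0,1]\times E\to E$ such that for $r,s\in[0,1]$: if $r+s\leq 1$ then $ra+sa$ is defined and equals $(r+s)a$; $(rs)a=r(sa)$; $0a=0$, $1a=a$; if $a+b$ is defined then $ra+rb$ is defined and equals $r(a+b)$. A sequential effect space (SES) is a convex $\sigma$-SEA. An order unit space $(V,C,1)$ is a real vector space with a proper cone $C$ ($C\cap(-C)=\{0\}$, $\mathrm{span}(C)=V$), ordered by $v\leq w\iff w-v\in C$, with an element $1$ such that every $v$ satisfies $-n1\leq v\leq n1$ for some $n\in\mathbb N$, and $v\leq\frac1n1$ for all $n\geq 1$ implies $v\leq 0$. Every SES $E$ is isomorphic, as a convex effect algebra, to the unit interval $[0,1]_V$ of an order unit space $V$; $E$ is identified with $[0,1]_V$ and carries the norm $\|v\|=\inf\{r>0:-r1\leq v\leq r1\}$. An effect $p$ is sharp if $b\leq p$ and $b\leq p^\perp$ imply $b=0$ (equivalently $p\circ p=p$). *)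

theory Defs
  imports "HOL-Analysis.Analysis"
begin

section \<open>Effect algebras\<close>

text \<open>
  The partial sum is encoded as an option-valued operation: \<open>x \<oplus> y = Some z\<close> means that
  \<open>x + y\<close> is defined and equal to \<open>z\<close>. Its values outside \<open>effects E\<close> are irrelevant.
\<close>

record 'e effect_structure =
  effects :: "'e set"
  ezero :: 'e ("\<zero>\<index>")
  eone :: 'e ("\<one>\<index>")
  eplus :: "'e \<Rightarrow> 'e \<Rightarrow> 'e option" (infixl "\<oplus>\<index>" 65)

locale effect_algebra =
  fixes E :: "'e effect_structure" (structure)
  assumes zero_closed: "\<zero> \<in> effects E"
    and one_closed: "\<one> \<in> effects E"
    and plus_closed:
      "\<lbrakk>x \<in> effects E; y \<in> effects E; x \<oplus> y = Some z\<rbrakk> \<Longrightarrow> z \<in> effects E"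
    and plus_commute:
      "\<lbrakk>x \<in> effects E; y \<in> effects E; x \<oplus> y = Some z\<rbrakk> \<Longrightarrow> y \<oplus> x = Some z"
    and plus_assoc:
      "\<lbrakk>x \<in> effects E; y \<in> effects E; z \<in> effects E; y \<oplus> z = Some u; x \<oplus> u = Some w\<rbrakk>
        \<Longrightarrow> \<exists>v. x \<oplus> y = Some v \<and> v \<oplus> z = Some w"
    and plus_zero: "x \<in> effects E \<Longrightarrow> x \<oplus> \<zero> = Some x"
    and plus_one: "\<lbrakk>x \<in> effects E; x \<oplus> \<one> \<noteq> None\<rbrakk> \<Longrightarrow> x = \<zero>"
    and complement: "x \<in> effects E \<Longrightarrow> \<exists>!y. y \<in> effects E \<and> x \<oplus> y = Some \<one>"

definition ecompl :: "'e effect_structure \<Rightarrow> 'e \<Rightarrow> 'e" where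
  "ecompl E x = (THE y. y \<in> effects E \<and> x \<oplus>\<^bsub>E\<^esub> y = Some \<one>\<^bsub>E\<^esub>)"

definition ele :: "'e effect_structure \<Rightarrow> 'e \<Rightarrow> 'e \<Rightarrow> bool" where
  "ele E x y \<longleftrightarrow> (\<exists>z \<in> effects E. x \<oplus>\<^bsub>E\<^esub> z = Some y)"

definition is_esup :: "'e effect_structure \<Rightarrow> 'e set \<Rightarrow> 'e \<Rightarrow> bool" where
  "is_esup E X m \<longleftrightarrow> m \<in> effects E \<and> (\<forall>x \<in> X. ele E x m) \<and>
     (\<forall>b \<in> effects E. (\<forall>x \<in> X. ele E x b) \<longrightarrow> ele E m b)"

definition is_einf :: "'e effect_structure \<Rightarrow> 'e set \<Rightarrow> 'e \<Rightarrow> bool" where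
  "is_einf E X m \<longleftrightarrow> m \<in> effects E \<and> (\<forall>x \<in> X. ele E m x) \<and>
     (\<forall>b \<in> effects E. (\<forall>x \<in> X. ele E b x) \<longrightarrow> ele E b m)"

definition sharp :: "'e effect_structure \<Rightarrow> 'e \<Rightarrow> bool" where
  "sharp E p \<longleftrightarrow> p \<in> effects E \<and>
     (\<forall>b \<in> effects E. ele E b p \<and> ele E b (ecompl E p) \<longrightarrow> b = \<zero>\<^bsub>E\<^esub>)"

text \<open>Finite sums; the result is \<open>None\<close> as soon as one of the partial sums is undefined.\<close>

primrec esum_list :: "'e effect_structure \<Rightarrow> 'e list \<Rightarrow> 'e option" where
  "esum_list E [] = Some \<zero>\<^bsub>E\<^esub>"
| "esum_list E (x # xs) = Option.bind (esum_list E xs) (\<lambda>s. x \<oplus>\<^bsub>E\<^esub> s)"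


section \<open>Sequential effect algebras\<close>

definition commutes :: "('e \<Rightarrow> 'e \<Rightarrow> 'e) \<Rightarrow> 'e \<Rightarrow> 'e \<Rightarrow> bool" where
  "commutes sp a b \<longleftrightarrow> sp a b = sp b a"

locale sequential_effect_algebra = effect_algebra E
  for E :: "'e effect_structure" (structure) +
  fixes seqprod :: "'e \<Rightarrow> 'e \<Rightarrow> 'e" (infixl "\<circ>\<^sub>s" 70)
  assumes seq_closed: "\<lbrakk>a \<in> effects E; b \<in> effects E\<rbrakk> \<Longrightarrow> a \<circ>\<^sub>s b \<in> effects E"
    and seq_plus:
      "\<lbrakk>a \<in> effects E; b \<in> effects E; c \<in> effects E; b \<oplus> c = Some d\<rbrakk>
        \<Longrightarrow> (a \<circ>\<^sub>s b) \<oplus> (a \<circ>\<^sub>s c) = Some (a \<circ>\<^sub>s d)"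
    and one_seq: "a \<in> effects E \<Longrightarrow> \<one> \<circ>\<^sub>s a = a"
    and seq_zero_sym:
      "\<lbrakk>a \<in> effects E; b \<in> effects E; a \<circ>\<^sub>s b = \<zero>\<rbrakk> \<Longrightarrow> b \<circ>\<^sub>s a = \<zero>"
    and commutes_compl:
      "\<lbrakk>a \<in> effects E; b \<in> effects E; commutes (\<circ>\<^sub>s) a b\<rbrakk>
        \<Longrightarrow> commutes (\<circ>\<^sub>s) a (ecompl E b)"
    and commutes_assoc:
      "\<lbrakk>a \<in> effects E; b \<in> effects E; c \<in> effects E; commutes (\<circ>\<^sub>s) a b\<rbrakk>
        \<Longrightarrow> a \<circ>\<^sub>s (b \<circ>\<^sub>s c) = (a \<circ>\<^sub>s b) \<circ>\<^sub>s c"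
    and commutes_seq:
      "\<lbrakk>a \<in> effects E; b \<in> effects E; c \<in> effects E;
        commutes (\<circ>\<^sub>s) c a; commutes (\<circ>\<^sub>s) c b\<rbrakk>
        \<Longrightarrow> commutes (\<circ>\<^sub>s) c (a \<circ>\<^sub>s b)"
    and commutes_plus:
      "\<lbrakk>a \<in> effects E; b \<in> effects E; c \<in> effects E;
        commutes (\<circ>\<^sub>s) c a; commutes (\<circ>\<^sub>s) c b; a \<oplus> b = Some d\<rbrakk>
        \<Longrightarrow> commutes (\<circ>\<^sub>s) c d"

definition orthogonal_effects ::
    "'e effect_structure \<Rightarrow> ('e \<Rightarrow> 'e \<Rightarrow> 'e) \<Rightarrow> 'e \<Rightarrow> 'e \<Rightarrow> bool" where
  "orthogonal_effects E sp a b \<longleftrightarrow> sp a b = \<zero>\<^bsub>E\<^esub>"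

locale sigma_sequential_effect_algebra = sequential_effect_algebra E seqprod
  for E :: "'e effect_structure" (structure) and seqprod (infixl "\<circ>\<^sub>s" 70) +
  assumes decreasing_inf:
      "\<lbrakk>range x \<subseteq> effects E; \<And>n::nat. ele E (x (Suc n)) (x n)\<rbrakk>
        \<Longrightarrow> \<exists>m. is_einf E (range x) m"
    and seq_inf:
      "\<lbrakk>range x \<subseteq> effects E; \<And>n::nat. ele E (x (Suc n)) (x n); is_einf E (range x) m;
        b \<in> effects E\<rbrakk>
        \<Longrightarrow> is_einf E (range (\<lambda>n. b \<circ>\<^sub>s x n)) (b \<circ>\<^sub>s m)"
    and commutes_inf:
      "\<lbrakk>range x \<subseteq> effects E; \<And>n::nat. ele E (x (Suc n)) (x n); is_einf E (range x) m;
        b \<in> effects E; \<And>n. commutes (\<circ>\<^sub>s) b (x n)\<rbrakk>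
        \<Longrightarrow> commutes (\<circ>\<^sub>s) b m"


section \<open>Convex effect algebras and sequential effect spaces\<close>

text \<open>The action is only constrained for scalars in \<open>[0, 1]\<close>.\<close>

locale convex_effect_algebra = effect_algebra E
  for E :: "'e effect_structure" (structure) +
  fixes smul :: "real \<Rightarrow> 'e \<Rightarrow> 'e" (infixr "\<cdot>" 75)
  assumes scale_closed: "\<lbrakk>r \<in> {0..1}; a \<in> effects E\<rbrakk> \<Longrightarrow> r \<cdot> a \<in> effects E"
    and scale_add:
      "\<lbrakk>r \<in> {0..1}; s \<in> {0..1}; r + s \<le> 1; a \<in> effects E\<rbrakk>
        \<Longrightarrow> (r \<cdot> a) \<oplus> (s \<cdot> a) = Some ((r + s) \<cdot> a)"
    and scale_scale:
      "\<lbrakk>r \<in> {0..1}; s \<in> {0..1}; a \<in> effects E\<rbrakk> \<Longrightarrow> (r * s) \<cdot> a = r \<cdot> (s \<cdot> a)"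
    and scale_zero: "a \<in> effects E \<Longrightarrow> 0 \<cdot> a = \<zero>"
    and scale_one: "a \<in> effects E \<Longrightarrow> 1 \<cdot> a = a"
    and scale_plus:
      "\<lbrakk>r \<in> {0..1}; a \<in> effects E; b \<in> effects E; a \<oplus> b = Some c\<rbrakk>
        \<Longrightarrow> (r \<cdot> a) \<oplus> (r \<cdot> b) = Some (r \<cdot> c)"

locale sequential_effect_space =
  sigma_sequential_effect_algebra E seqprod + convex_effect_algebra E smul
  for E :: "'e effect_structure" (structure)
    and seqprod :: "'e \<Rightarrow> 'e \<Rightarrow> 'e" and smul :: "real \<Rightarrow> 'e \<Rightarrow> 'e"

text \<open>
  The two effect structures need not have the same element type. The sum is required to be
  defined on one side exactly if it is defined on the other.
\<close>

definition convex_effect_iso ::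
    "'e effect_structure \<Rightarrow> (real \<Rightarrow> 'e \<Rightarrow> 'e) \<Rightarrow>
     'f effect_structure \<Rightarrow> (real \<Rightarrow> 'f \<Rightarrow> 'f) \<Rightarrow> ('e \<Rightarrow> 'f) \<Rightarrow> bool" where
  "convex_effect_iso E smul F smul' \<phi> \<longleftrightarrow>
     bij_betw \<phi> (effects E) (effects F) \<and>
     \<phi> \<zero>\<^bsub>E\<^esub> = \<zero>\<^bsub>F\<^esub> \<and> \<phi> \<one>\<^bsub>E\<^esub> = \<one>\<^bsub>F\<^esub> \<and>
     (\<forall>x \<in> effects E. \<forall>y \<in> effects E. \<phi> x \<oplus>\<^bsub>F\<^esub> \<phi> y = map_option \<phi> (x \<oplus>\<^bsub>E\<^esub> y)) \<and>
     (\<forall>r \<in> {0..1}. \<forall>x \<in> effects E. \<phi> (smul r x) = smul' r (\<phi> x))"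


section \<open>Order unit spaces\<close>

definition cone_le :: "'v::real_vector set \<Rightarrow> 'v \<Rightarrow> 'v \<Rightarrow> bool" where
  "cone_le C v w \<longleftrightarrow> w - v \<in> C"

locale order_unit_space =
  fixes C :: "'v::real_vector set" and u :: 'v
  assumes cone_C: "convex_cone C"
    and proper: "C \<inter> uminus ` C = {0}"
    and generating: "span C = UNIV"
    and order_unit: "\<exists>n::nat. cone_le C (- (real n *\<^sub>R u)) v \<and> cone_le C v (real n *\<^sub>R u)"
    and archimedean:
      "(\<And>n::nat. n \<ge> 1 \<Longrightarrow> cone_le C v ((1 / real n) *\<^sub>R u)) \<Longrightarrow> cone_le C v 0"

text \<open>For \<open>v\<close>, \<open>w\<close> in the interval, \<open>0 \<le> v + w\<close> is automatic.\<close>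

definition unit_interval :: "'v::real_vector set \<Rightarrow> 'v \<Rightarrow> 'v effect_structure" where
  "unit_interval C u =
     \<lparr>effects = {v. cone_le C 0 v \<and> cone_le C v u}, ezero = 0, eone = u,
      eplus = (\<lambda>v w. if cone_le C (v + w) u then Some (v + w) else None)\<rparr>"

definition order_unit_norm :: "'v::real_vector set \<Rightarrow> 'v \<Rightarrow> 'v \<Rightarrow> real" where
  "order_unit_norm C u v = Inf {r. r > 0 \<and> cone_le C (- (r *\<^sub>R u)) v \<and> cone_le C v (r *\<^sub>R u)}"

end

theory Submission
  imports Defs
begin

text \<open>
  The product is moved to the unit interval of the order unit space. There the iteration
  \<open>w\<^sub>0 = 0\<close>, \<open>w\<^sub>n\<^sub>+\<^sub>1 = a(1 - a) + w\<^sub>n\<^sup>2\<close> increases to some \<open>w \<le> a\<close>, \<open>w \<le> 1 - a\<close> with \<open>(a - w)(1 - a - w) = 0\<close>.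
  If \<open>q\<close> is the infimum of the powers of \<open>1 - (a - w)\<close>, then \<open>p = 1 - q\<close> is sharp and \<open>2a - p\<close> is
  again an effect in the bicommutant of \<open>a\<close>. Iterating \<open>a \<mapsto> 2a - p\<close> gives a binary expansion
  \<open>a = \<Sum>\<^sub>n 2\<^sup>-\<^sup>n p\<^sub>n\<close> with commuting sharp effects \<open>p\<^sub>n\<close>. A partial sum with \<open>n\<close> terms is within
  \<open>2\<^sup>-\<^sup>n\<close> of \<open>a\<close>, and the products of the \<open>p\<^sub>i\<close> and \<open>1 - p\<^sub>i\<close> refine it to a combination of orthogonal
  sharp effects.
\<close>

section \<open>Isomorphic effect algebras\<close>

text \<open>\<open>F\<close> is a bare structure here; that it is an effect algebra is derived.
  Stating \<open>iso_plus\<close> with \<open>map_option\<close> transports definedness of sums in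
  both directions.\<close>

locale effect_algebra_iso = effect_algebra E
  for E :: "'e effect_structure" (structure) +
  fixes F :: "'f effect_structure" and \<phi> :: "'e \<Rightarrow> 'f"
  assumes bij: "bij_betw \<phi> (effects E) (effects F)"
    and iso_zero: "\<phi> \<zero> = \<zero>\<^bsub>F\<^esub>"
    and iso_one: "\<phi> \<one> = \<one>\<^bsub>F\<^esub>"
    and iso_plus: "\<lbrakk>x \<in> effects E; y \<in> effects E\<rbrakk>
      \<Longrightarrow> \<phi> x \<oplus>\<^bsub>F\<^esub> \<phi> y = map_option \<phi> (x \<oplus> y)"
begin

definition \<psi> :: "'f \<Rightarrow> 'e" where
  "\<psi> = inv_into (effects E) \<phi>"

lemma effects_F: "effects F = \<phi> ` effects E"
  using bij by (simp add: bij_betw_def)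

lemma psi_phi [simp]: "x \<in> effects E \<Longrightarrow> \<psi> (\<phi> x) = x"
  using bij by (simp add: \<psi>_def bij_betw_def inv_into_f_f)

lemma phi_psi [simp]: "x \<in> effects F \<Longrightarrow> \<phi> (\<psi> x) = x"
  by (auto simp: effects_F)

lemma psi_closed [simp]: "x \<in> effects F \<Longrightarrow> \<psi> x \<in> effects E"
  by (auto simp: effects_F)

lemma phi_closed [simp]: "x \<in> effects E \<Longrightarrow> \<phi> x \<in> effects F"
  by (auto simp: effects_F)

lemma phi_eq_iff: "\<lbrakk>x \<in> effects E; y \<in> effects E\<rbrakk> \<Longrightarrow> \<phi> x = \<phi> y \<longleftrightarrow> x = y"
  using psi_phi by metis

lemma iso_plus_iff:
  assumes "x \<in> effects E" "y \<in> effects E" "z \<in> effects E"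
  shows "\<phi> x \<oplus>\<^bsub>F\<^esub> \<phi> y = Some (\<phi> z) \<longleftrightarrow> x \<oplus> y = Some z"
  using assms phi_eq_iff plus_closed[OF assms(1,2)] by (cases "x \<oplus> y") (auto simp: iso_plus)

lemma iso_plus_SomeE:
  assumes "x \<in> effects E" "y \<in> effects E" "\<phi> x \<oplus>\<^bsub>F\<^esub> \<phi> y = Some z'"
  obtains z where "z \<in> effects E" "z' = \<phi> z" "x \<oplus> y = Some z"
  using assms plus_closed[OF assms(1,2)] by (auto simp: iso_plus)

lemma effect_algebra_F: "effect_algebra F"
proof
  show "\<zero>\<^bsub>F\<^esub> \<in> effects F" "\<one>\<^bsub>F\<^esub> \<in> effects F"
    using zero_closed one_closed iso_zero iso_one phi_closed by metis+
next
  fix x y z assume "x \<in> effects F" "y \<in> effects F" and xy: "x \<oplus>\<^bsub>F\<^esub> y = Some z"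
  then obtain x' y' where x: "x = \<phi> x'" "x' \<in> effects E" and y: "y = \<phi> y'" "y' \<in> effects E"
    by (auto simp: effects_F)
  obtain z' where z: "z' \<in> effects E" "z = \<phi> z'" "x' \<oplus> y' = Some z'"
    using iso_plus_SomeE xy x y by metis
  then show "z \<in> effects F" by simp
  show "y \<oplus>\<^bsub>F\<^esub> x = Some z"
    using x y z plus_commute[of x' y' z'] by (simp add: iso_plus_iff)
next
  fix x y z v w
  assume "x \<in> effects F" "y \<in> effects F" "z \<in> effects F"
    and vw: "y \<oplus>\<^bsub>F\<^esub> z = Some v" "x \<oplus>\<^bsub>F\<^esub> v = Some w"
  then obtain x' y' z' where x: "x = \<phi> x'" "x' \<in> effects E" and y: "y = \<phi> y'" "y' \<in> effects E"
    and z: "z = \<phi> z'" "z' \<in> effects E"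
    by (auto simp: effects_F)
  obtain v' where v: "v' \<in> effects E" "v = \<phi> v'" "y' \<oplus> z' = Some v'"
    using iso_plus_SomeE vw(1) y z by metis
  obtain w' where w: "w' \<in> effects E" "w = \<phi> w'" "x' \<oplus> v' = Some w'"
    using iso_plus_SomeE vw(2) x v by metis
  obtain t where t: "x' \<oplus> y' = Some t" "t \<oplus> z' = Some w'"
    using plus_assoc x y z v w by meson
  with plus_closed x y have "t \<in> effects E" by blast
  then show "\<exists>v. x \<oplus>\<^bsub>F\<^esub> y = Some v \<and> v \<oplus>\<^bsub>F\<^esub> z = Some w"
    using t x y z w by (intro exI[of _ "\<phi> t"]) (simp add: iso_plus_iff)
next
  fix x assume "x \<in> effects F"
  then obtain x' where x: "x = \<phi> x'" "x' \<in> effects E" by (auto simp: effects_F)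
  show "x \<oplus>\<^bsub>F\<^esub> \<zero>\<^bsub>F\<^esub> = Some x"
    using x plus_zero zero_closed by (simp flip: iso_zero add: iso_plus_iff)
  show "x = \<zero>\<^bsub>F\<^esub>" if "x \<oplus>\<^bsub>F\<^esub> \<one>\<^bsub>F\<^esub> \<noteq> None"
    using that x plus_one one_closed by (auto simp flip: iso_zero iso_one simp: iso_plus)
  obtain y where y: "y \<in> effects E" "x' \<oplus> y = Some \<one>"
    using complement x by blast
  show "\<exists>!y. y \<in> effects F \<and> x \<oplus>\<^bsub>F\<^esub> y = Some \<one>\<^bsub>F\<^esub>"
  proof (rule ex1I[of _ "\<phi> y"])
    show "\<phi> y \<in> effects F \<and> x \<oplus>\<^bsub>F\<^esub> \<phi> y = Some \<one>\<^bsub>F\<^esub>"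
      using x y one_closed by (simp flip: iso_one add: iso_plus_iff)
    fix z assume "z \<in> effects F \<and> x \<oplus>\<^bsub>F\<^esub> z = Some \<one>\<^bsub>F\<^esub>"
    then obtain z' where z: "z = \<phi> z'" "z' \<in> effects E" "x \<oplus>\<^bsub>F\<^esub> z = Some \<one>\<^bsub>F\<^esub>"
      by (auto simp: effects_F)
    then have "x' \<oplus> z' = Some \<one>"
      using x one_closed by (simp flip: iso_one add: iso_plus_iff)
    then show "z = \<phi> y" using complement x y z by blast
  qed
qed

section \<open>Complements, order, infima, suprema, sharpness and finite sums under the
  isomorphism\<close>

lemma ecompl_closed: "x \<in> effects E \<Longrightarrow> ecompl E x \<in> effects E"
  and ecompl_plus: "x \<in> effects E \<Longrightarrow> x \<oplus> ecompl E x = Some \<one>"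
  using theI'[OF complement[of x]] by (auto simp: ecompl_def)

lemma iso_ecompl:
  assumes "x \<in> effects E"
  shows "ecompl F (\<phi> x) = \<phi> (ecompl E x)"
proof -
  have "\<phi> x \<oplus>\<^bsub>F\<^esub> \<phi> (ecompl E x) = Some \<one>\<^bsub>F\<^esub>"
    using assms ecompl_closed ecompl_plus one_closed by (simp flip: iso_one add: iso_plus_iff)
  then show ?thesis
    unfolding ecompl_def[of F]
    using assms ecompl_closed effect_algebra.complement[OF effect_algebra_F, of "\<phi> x"]
    by (intro the1_equality) auto
qed

lemma iso_ele:
  assumes "x \<in> effects E" "y \<in> effects E"
  shows "ele F (\<phi> x) (\<phi> y) \<longleftrightarrow> ele E x y"
  using assms by (auto simp: ele_def effects_F iso_plus_iff)

lemma ele_psi: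
  assumes "x \<in> effects F" "y \<in> effects F"
  shows "ele E (\<psi> x) (\<psi> y) \<longleftrightarrow> ele F x y"
  using assms iso_ele[of "\<psi> x" "\<psi> y"] by simp

lemma iso_is_einf:
  assumes "X \<subseteq> effects E" "m \<in> effects E"
  shows "is_einf F (\<phi> ` X) (\<phi> m) \<longleftrightarrow> is_einf E X m"
  using assms iso_ele subsetD[OF assms(1)] by (auto simp: is_einf_def effects_F)

lemma iso_is_esup:
  assumes "X \<subseteq> effects E" "m \<in> effects E"
  shows "is_esup F (\<phi> ` X) (\<phi> m) \<longleftrightarrow> is_esup E X m"
  using assms iso_ele subsetD[OF assms(1)] by (auto simp: is_esup_def effects_F)

lemma iso_sharp:
  assumes "p \<in> effects E"
  shows "sharp F (\<phi> p) \<longleftrightarrow> sharp E p"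
  using assms ecompl_closed zero_closed
  by (auto simp: sharp_def effects_F iso_ecompl iso_ele phi_eq_iff simp flip: iso_zero)

text \<open>The closure claim is carried through the induction because \<open>iso_plus\<close>
  applies only once the sum of the tail is known to be an effect.\<close>

lemma iso_esum_list:
  assumes "set xs \<subseteq> effects E"
  shows "esum_list F (map \<phi> xs) = map_option \<phi> (esum_list E xs) \<and>
    set_option (esum_list E xs) \<subseteq> effects E"
  using assms
proof (induction xs)
  case Nil
  then show ?case using zero_closed by (simp add: iso_zero)
next
  case (Cons x xs)
  then show ?case
    using plus_closed by (cases "esum_list E xs") (auto simp: iso_plus)
qed

text \<open>Conjugating the product by the bijection turns each axiom on \<open>F\<close> into the
  same axiom on \<open>E\<close>; sums, complements and infima are pulled back by the lemmas
  above.\<close>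

lemma iso_sigma_sequential_effect_algebra:
  assumes "sigma_sequential_effect_algebra E sp"
  shows "sigma_sequential_effect_algebra F (\<lambda>x y. \<phi> (sp (\<psi> x) (\<psi> y)))"
proof -
  interpret S: sigma_sequential_effect_algebra E sp by fact
  interpret F: effect_algebra F by (rule effect_algebra_F)
  let ?sq = "\<lambda>x y. \<phi> (sp (\<psi> x) (\<psi> y))"
  have comm: "commutes ?sq (\<phi> x) (\<phi> y) \<longleftrightarrow> commutes sp x y"
    if "x \<in> effects E" "y \<in> effects E" for x y
    using that S.seq_closed by (simp add: commutes_def phi_eq_iff)
  show ?thesis
  proof
    fix a b assume "a \<in> effects F" "b \<in> effects F"
    then obtain x y where x: "a = \<phi> x" "x \<in> effects E" and y: "b = \<phi> y" "y \<in> effects E"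
      by (auto simp: effects_F)
    show "?sq a b \<in> effects F"
      using x y S.seq_closed by simp
    show "?sq \<one>\<^bsub>F\<^esub> a = a"
      using x one_closed S.one_seq by (simp flip: iso_one)
    show "?sq b a = \<zero>\<^bsub>F\<^esub>" if "?sq a b = \<zero>\<^bsub>F\<^esub>"
      using that x y zero_closed S.seq_closed S.seq_zero_sym
      by (simp flip: iso_zero add: phi_eq_iff)
    show "commutes ?sq a (ecompl F b)" if "commutes ?sq a b"
      using that x y S.commutes_compl ecompl_closed by (simp add: comm iso_ecompl)
    fix c assume "c \<in> effects F"
    then obtain z where z: "c = \<phi> z" "z \<in> effects E" by (auto simp: effects_F)
    show "?sq a b \<oplus>\<^bsub>F\<^esub> ?sq a c = Some (?sq a d)" if "b \<oplus>\<^bsub>F\<^esub> c = Some d" for d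
    proof -
      from that y z obtain t where "t \<in> effects E" "d = \<phi> t" "y \<oplus> z = Some t"
        using iso_plus_SomeE by metis
      then show ?thesis
        using x y z S.seq_plus S.seq_closed by (simp add: iso_plus_iff)
    qed
    show "?sq a (?sq b c) = ?sq (?sq a b) c" if "commutes ?sq a b"
      using that x y z S.commutes_assoc S.seq_closed by (simp add: comm)
    show "commutes ?sq c (?sq a b)" if "commutes ?sq c a" "commutes ?sq c b"
      using that x y z S.commutes_seq S.seq_closed by (simp add: comm)
    show "commutes ?sq c d"
      if "commutes ?sq c a" "commutes ?sq c b" "a \<oplus>\<^bsub>F\<^esub> b = Some d" for d
    proof -
      from that x y obtain t where "t \<in> effects E" "d = \<phi> t" "x \<oplus> y = Some t"
        using iso_plus_SomeE by metis
      then show ?thesis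
        using that x y z S.commutes_plus[of x y z t] by (simp add: comm)
    qed
  next
    fix x :: "nat \<Rightarrow> 'f"
    assume "range x \<subseteq> effects F" and dec: "\<And>n. ele F (x (Suc n)) (x n)"
    then have x: "x n \<in> effects F" for n by auto
    define y where "y n = \<psi> (x n)" for n
    have y: "range y \<subseteq> effects E" "y n \<in> effects E" "x n = \<phi> (y n)" for n
      using x by (auto simp: y_def)
    have ydec: "ele E (y (Suc n)) (y n)" for n
      using dec x by (simp add: y_def ele_psi)
    have rx: "range x = \<phi> ` range y"
      using y(3) by auto
    obtain m where "is_einf E (range y) m" "m \<in> effects E"
      using S.decreasing_inf[OF y(1) ydec] by (auto simp: is_einf_def)
    then show "\<exists>m. is_einf F (range x) m"
      using iso_is_einf[OF y(1)] rx by metis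
    fix m b assume m: "is_einf F (range x) m" and b: "b \<in> effects F"
    then obtain m' b' where m': "m' \<in> effects E" "m = \<phi> m'" and b': "b' \<in> effects E" "b = \<phi> b'"
      by (auto simp: effects_F is_einf_def)
    have ym: "is_einf E (range y) m'"
      using m m' iso_is_einf[OF y(1)] by (simp add: rx)
    have "is_einf E (range (\<lambda>n. sp b' (y n))) (sp b' m')"
      using S.seq_inf[OF y(1) ydec ym b'(1)] .
    moreover have "range (\<lambda>n. ?sq b (x n)) = \<phi> ` range (\<lambda>n. sp b' (y n))"
      using y b' by auto
    ultimately show "is_einf F (range (\<lambda>n. ?sq b (x n))) (?sq b m)"
      using m' b' y iso_is_einf[of "range (\<lambda>n. sp b' (y n))" "sp b' m'"] S.seq_closed
      by (auto simp: image_subset_iff)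
    show "commutes ?sq b m" if "\<And>n. commutes ?sq b (x n)"
      using that S.commutes_inf[OF y(1) ydec ym b'(1)] y m' b' by (simp add: comm)
  qed
qed

end

section \<open>Unit intervals of order unit spaces\<close>

context order_unit_space
begin

abbreviation le :: "'v \<Rightarrow> 'v \<Rightarrow> bool" (infix "\<preceq>" 50) where
  "x \<preceq> y \<equiv> cone_le C x y"

definition I :: "'v set" where
  "I = {v. 0 \<preceq> v \<and> v \<preceq> u}"

section \<open>Order and scaling in an order unit space\<close>

lemma cone_zero: "0 \<in> C"
  using cone_C by (rule convex_cone_contains_0)

lemma cone_add: "\<lbrakk>x \<in> C; y \<in> C\<rbrakk> \<Longrightarrow> x + y \<in> C"
  using cone_C by (rule convex_cone_add)

lemma cone_scale: "\<lbrakk>x \<in> C; 0 \<le> r\<rbrakk> \<Longrightarrow> r *\<^sub>R x \<in> C"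
  using convex_cone_scaleR[OF cone_C] by simp

lemma le_refl [simp]: "x \<preceq> x"
  using cone_zero by (simp add: cone_le_def)

lemma le_trans [trans]: "\<lbrakk>x \<preceq> y; y \<preceq> z\<rbrakk> \<Longrightarrow> x \<preceq> z"
  using cone_add[of "y - x" "z - y"] by (simp add: cone_le_def)

lemma le_antisym: assumes "x \<preceq> y" "y \<preceq> x" shows "x = y"
proof -
  have "x - y \<in> C \<inter> uminus ` C"
    using assms by (auto simp: cone_le_def image_iff intro!: bexI[of _ "y - x"])
  then show ?thesis using proper by simp
qed

lemma le_add_mono: "\<lbrakk>x \<preceq> y; v \<preceq> w\<rbrakk> \<Longrightarrow> x + v \<preceq> y + w"
  using cone_add[of "y - x" "w - v"] by (simp add: cone_le_def algebra_simps)

lemma le_add_left_iff [simp]: "v + x \<preceq> v + y \<longleftrightarrow> x \<preceq> y"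
  by (simp add: cone_le_def)

lemma le_diff_left_iff [simp]: "v - x \<preceq> v - y \<longleftrightarrow> y \<preceq> x"
  by (simp add: cone_le_def)

lemma le_diff_comm: "x \<preceq> v - y \<longleftrightarrow> y \<preceq> v - x"
  by (simp add: cone_le_def algebra_simps)

lemma diff_le_comm: "v - x \<preceq> y \<longleftrightarrow> v - y \<preceq> x"
  by (simp add: cone_le_def algebra_simps)

lemma le_diff_eq: "x \<preceq> v - y \<longleftrightarrow> x + y \<preceq> v"
  by (simp add: cone_le_def algebra_simps)

lemma zero_le_diff_iff [simp]: "0 \<preceq> y - x \<longleftrightarrow> x \<preceq> y"
  by (simp add: cone_le_def)

lemma diff_le_iff [simp]: "v - x \<preceq> v \<longleftrightarrow> 0 \<preceq> x"
  by (simp add: cone_le_def)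

lemma le_add_same: "0 \<preceq> y \<Longrightarrow> x \<preceq> x + y"
  by (simp add: cone_le_def)

lemma scale_nonneg: "\<lbrakk>0 \<preceq> x; 0 \<le> r\<rbrakk> \<Longrightarrow> 0 \<preceq> r *\<^sub>R x"
  using cone_scale by (simp add: cone_le_def)

lemma scale_mono: "\<lbrakk>x \<preceq> y; 0 \<le> r\<rbrakk> \<Longrightarrow> r *\<^sub>R x \<preceq> r *\<^sub>R y"
  using cone_scale[of "y - x" r] by (simp add: cone_le_def scaleR_diff_right)

lemma scale_mono_left: "\<lbrakk>0 \<preceq> x; r \<le> s\<rbrakk> \<Longrightarrow> r *\<^sub>R x \<preceq> s *\<^sub>R x"
  using cone_scale[of x "s - r"] by (simp add: cone_le_def scaleR_diff_left)

text \<open>The order unit axiom applied to \<open>u\<close> itself gives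
  \<open>- (real n *\<^sub>R u) \<preceq> u\<close>, hence \<open>(real n + 1) *\<^sub>R u\<close>
  is positive; dividing by the scalar leaves \<open>u\<close>.\<close>

lemma u_nonneg: "0 \<preceq> u"
proof -
  obtain n :: nat where n: "- (real n *\<^sub>R u) \<preceq> u" "u \<preceq> real n *\<^sub>R u"
    using order_unit by blast
  have "0 \<preceq> (real n + 1) *\<^sub>R u"
    using n(1) by (simp add: cone_le_def algebra_simps)
  from scale_nonneg[OF this, of "1 / (real n + 1)"] show ?thesis
    by simp
qed

lemma I_iff: "x \<in> I \<longleftrightarrow> 0 \<preceq> x \<and> x \<preceq> u"
  by (simp add: I_def)

lemma I_subinterval: "\<lbrakk>x \<in> I; 0 \<preceq> y; y \<preceq> x\<rbrakk> \<Longrightarrow> y \<in> I"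
  by (auto simp: I_iff intro: le_trans)

lemma zero_in_I [simp]: "0 \<in> I" and u_in_I [simp]: "u \<in> I"
  using u_nonneg by (auto simp: I_iff)

lemma compl_in_I [simp]: "x \<in> I \<Longrightarrow> u - x \<in> I"
  by (simp add: I_iff)

lemma diff_in_I: "\<lbrakk>x \<in> I; y \<in> I; y \<preceq> x\<rbrakk> \<Longrightarrow> x - y \<in> I"
  by (rule I_subinterval[of x]) (auto simp: I_iff)

section \<open>Effect algebra notions on the unit interval\<close>

lemma effects_unit_interval [simp]: "effects (unit_interval C u) = I"
  by (simp add: unit_interval_def I_def)

lemma ezero_unit_interval [simp]: "\<zero>\<^bsub>unit_interval C u\<^esub> = 0"
  and eone_unit_interval [simp]: "\<one>\<^bsub>unit_interval C u\<^esub> = u"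
  by (simp_all add: unit_interval_def)

lemma eplus_unit_interval:
  "x \<oplus>\<^bsub>unit_interval C u\<^esub> y = (if x + y \<preceq> u then Some (x + y) else None)"
  by (simp add: unit_interval_def)

lemma eplus_unit_interval_Some [simp]:
  "x \<oplus>\<^bsub>unit_interval C u\<^esub> y = Some z \<longleftrightarrow> x + y \<preceq> u \<and> z = x + y"
  by (auto simp: eplus_unit_interval)

lemma ele_unit_interval [simp]:
  assumes "x \<in> I" "y \<in> I"
  shows "ele (unit_interval C u) x y \<longleftrightarrow> x \<preceq> y"
proof
  show "x \<preceq> y" if "ele (unit_interval C u) x y"
    using that by (auto simp: ele_def I_iff intro: le_add_same)
  show "ele (unit_interval C u) x y" if "x \<preceq> y"
    using that assms diff_in_I[of y x] by (auto simp: ele_def I_iff intro!: bexI[of _ "y - x"])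
qed

lemma ecompl_unit_interval [simp]:
  assumes "x \<in> I"
  shows "ecompl (unit_interval C u) x = u - x"
  unfolding ecompl_def
proof (rule the_equality)
  show "u - x \<in> effects (unit_interval C u) \<and>
      x \<oplus>\<^bsub>unit_interval C u\<^esub> (u - x) = Some \<one>\<^bsub>unit_interval C u\<^esub>"
    using assms by simp
qed auto

lemma is_einf_unit_interval:
  assumes "X \<subseteq> I"
  shows "is_einf (unit_interval C u) X m \<longleftrightarrow>
    m \<in> I \<and> (\<forall>x\<in>X. m \<preceq> x) \<and> (\<forall>b\<in>I. (\<forall>x\<in>X. b \<preceq> x) \<longrightarrow> b \<preceq> m)"
  unfolding is_einf_def effects_unit_interval
  using assms ele_unit_interval by (metis subsetD)

lemma is_esup_unit_interval:
  assumes "X \<subseteq> I"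
  shows "is_esup (unit_interval C u) X m \<longleftrightarrow>
    m \<in> I \<and> (\<forall>x\<in>X. x \<preceq> m) \<and> (\<forall>b\<in>I. (\<forall>x\<in>X. x \<preceq> b) \<longrightarrow> m \<preceq> b)"
  unfolding is_esup_def effects_unit_interval
  using assms ele_unit_interval by (metis subsetD)

lemma sum_list_nonneg_cone: "(\<And>x. x \<in> set xs \<Longrightarrow> 0 \<preceq> x) \<Longrightarrow> 0 \<preceq> sum_list xs"
  by (induction xs) (auto simp: cone_le_def intro: cone_zero cone_add)

text \<open>Since the entries are positive, each partial sum lies below the total and hence below
  \<open>u\<close>, so no intermediate sum is undefined.\<close>

lemma esum_list_unit_interval:
  assumes "\<And>x. x \<in> set xs \<Longrightarrow> 0 \<preceq> x" "sum_list xs \<preceq> u"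
  shows "esum_list (unit_interval C u) xs = Some (sum_list xs)"
  using assms
proof (induction xs)
  case (Cons x xs)
  have "sum_list xs \<preceq> x + sum_list xs"
    using Cons.prems(1) by (simp add: cone_le_def)
  then have "sum_list xs \<preceq> u"
    using Cons.prems(2) le_trans[of "sum_list xs"] by simp
  then show ?case using Cons by simp
qed simp

lemma order_unit_norm_bounds:
  assumes "0 < r" "- (r *\<^sub>R u) \<preceq> v" "v \<preceq> r *\<^sub>R u"
  shows "0 \<le> order_unit_norm C u v" "order_unit_norm C u v \<le> r"
proof -
  let ?S = "{r. r > 0 \<and> - (r *\<^sub>R u) \<preceq> v \<and> v \<preceq> r *\<^sub>R u}"
  \<comment> \<open>Both bounds use this member: \<open>cInf_greatest\<close> yields nonnegativity
    only for a nonempty set.\<close>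
  have "r \<in> ?S" using assms by simp
  then show "0 \<le> order_unit_norm C u v"
    unfolding order_unit_norm_def by (intro cInf_greatest) auto
  show "order_unit_norm C u v \<le> r"
    unfolding order_unit_norm_def using \<open>r \<in> ?S\<close>
    by (intro cInf_lower bdd_belowI[of _ 0]) auto
qed

text \<open>The Archimedean axiom in dyadic form, fitted to the error of a binary expansion.\<close>

lemma le_zero_if_le_powers:
  assumes "\<And>n. v \<preceq> (1 / 2) ^ n *\<^sub>R u"
  shows "v \<preceq> 0"
proof (rule archimedean)
  fix n :: nat assume "n \<ge> 1"
  have "real n \<le> 2 ^ n" by (simp add: less_imp_le)
  then have "(1 / 2) ^ n \<le> 1 / real n"
    using \<open>n \<ge> 1\<close> by (simp add: power_one_over frac_le)
  then show "v \<preceq> (1 / real n) *\<^sub>R u"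
    using assms[of n] scale_mono_left[OF u_nonneg] le_trans by blast
qed

end

section \<open>Spectral projections\<close>

text \<open>Sums, differences and scalars are those of the vector space, so equations between
  effects can be rearranged freely; the product is constrained only on \<open>I\<close>.\<close>

locale interval_sigma_sea = order_unit_space C u + sigma_sequential_effect_algebra "unit_interval C u" sq
  for C :: "'v::real_vector set" and u :: 'v and sq :: "'v \<Rightarrow> 'v \<Rightarrow> 'v" (infixl "\<odot>" 70)
begin

definition comm :: "'v \<Rightarrow> 'v \<Rightarrow> bool" (infix "\<parallel>" 50) where
  "a \<parallel> b \<longleftrightarrow> a \<odot> b = b \<odot> a"

section \<open>Arithmetic of the sequential product on the interval\<close>

lemma commutes_iff: "commutes (\<odot>) a b \<longleftrightarrow> a \<parallel> b"
  by (simp add: comm_def commutes_def)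

lemma comm_refl [simp]: "a \<parallel> a" and comm_sym: "a \<parallel> b \<Longrightarrow> b \<parallel> a"
  by (simp_all add: comm_def)

lemma sq_in_I [simp]: "\<lbrakk>a \<in> I; b \<in> I\<rbrakk> \<Longrightarrow> a \<odot> b \<in> I"
  using seq_closed by simp

lemma sq_add: "\<lbrakk>a \<in> I; b \<in> I; c \<in> I; b + c \<preceq> u\<rbrakk> \<Longrightarrow> a \<odot> (b + c) = a \<odot> b + a \<odot> c"
  using seq_plus[of a b c "b + c"] by simp

lemma sq_diff: "\<lbrakk>a \<in> I; b \<in> I; c \<in> I; c \<preceq> b\<rbrakk> \<Longrightarrow> a \<odot> (b - c) = a \<odot> b - a \<odot> c"
  using sq_add[of a c "b - c"] diff_in_I[of b c] by (auto simp: I_iff)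

lemma one_sq [simp]: "a \<in> I \<Longrightarrow> u \<odot> a = a"
  using one_seq by simp

lemma sq_zero [simp]: "a \<in> I \<Longrightarrow> a \<odot> 0 = 0"
  using sq_add[of a 0 0] u_nonneg by simp

lemma sq_zero_sym: "\<lbrakk>a \<in> I; b \<in> I; a \<odot> b = 0\<rbrakk> \<Longrightarrow> b \<odot> a = 0"
  using seq_zero_sym by simp

lemma zero_sq [simp]: "a \<in> I \<Longrightarrow> 0 \<odot> a = 0"
  using sq_zero_sym[of a 0] by simp

lemma comm_compl: "\<lbrakk>a \<in> I; b \<in> I; a \<parallel> b\<rbrakk> \<Longrightarrow> a \<parallel> u - b"
  using commutes_compl[of a b] by (simp add: commutes_iff)

text \<open>\<open>a\<close> commutes with \<open>0\<close> because both products vanish, and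
  \<open>u\<close> is the complement of \<open>0\<close>.\<close>

lemma comm_one: "a \<in> I \<Longrightarrow> a \<parallel> u"
  using comm_compl[of a 0] by (simp add: comm_def)

lemma sq_one [simp]: "a \<in> I \<Longrightarrow> a \<odot> u = a"
  using comm_one[of a] by (simp add: comm_def)

lemma sq_assoc: "\<lbrakk>a \<in> I; b \<in> I; c \<in> I; a \<parallel> b\<rbrakk> \<Longrightarrow> a \<odot> (b \<odot> c) = a \<odot> b \<odot> c"
  using commutes_assoc by (simp add: commutes_iff)

lemma sq_compl: "\<lbrakk>a \<in> I; b \<in> I\<rbrakk> \<Longrightarrow> a \<odot> (u - b) = a - a \<odot> b"
  using sq_diff[of a u b] I_iff[of b] by simp

lemma comm_sq: "\<lbrakk>a \<in> I; b \<in> I; c \<in> I; c \<parallel> a; c \<parallel> b\<rbrakk> \<Longrightarrow> c \<parallel> a \<odot> b"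
  using commutes_seq by (simp add: commutes_iff)

lemma comm_add: "\<lbrakk>a \<in> I; b \<in> I; c \<in> I; c \<parallel> a; c \<parallel> b; a + b \<preceq> u\<rbrakk> \<Longrightarrow> c \<parallel> a + b"
  using commutes_plus[of a b c "a + b"] by (simp add: commutes_iff)

text \<open>The axioms cover complements and defined sums, and \<open>a - b\<close> is the
  complement of \<open>(u - a) + b\<close>.\<close>

lemma comm_diff:
  assumes "a \<in> I" "b \<in> I" "c \<in> I" "c \<parallel> a" "c \<parallel> b" "b \<preceq> a"
  shows "c \<parallel> a - b"
proof -
  have "(u - a) + b \<preceq> u"
    using assms(6) by (simp add: cone_le_def)
  moreover from this have "(u - a) + b \<in> I"
    using assms le_add_mono[of 0 "u - a" 0 b] by (simp add: I_iff)
  ultimately have "c \<parallel> u - ((u - a) + b)"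
    using assms by (intro comm_compl comm_add) auto
  then show ?thesis by simp
qed

lemma sq_mono: "\<lbrakk>a \<in> I; b \<in> I; c \<in> I; b \<preceq> c\<rbrakk> \<Longrightarrow> a \<odot> b \<preceq> a \<odot> c"
  using sq_diff[of a c b] sq_in_I[of a "c - b"] diff_in_I[of c b] by (simp add: I_iff)

lemma sq_le_left: "\<lbrakk>a \<in> I; b \<in> I\<rbrakk> \<Longrightarrow> a \<odot> b \<preceq> a"
  using sq_mono[of a b u] by (simp add: I_iff u_nonneg)

text \<open>Idempotence makes \<open>q\<close> and \<open>u - q\<close> orthogonal. An effect
  \<open>b\<close> below both is then annihilated by each from the left, hence also from the right
  by symmetry of zero products, and \<open>b\<close> is the sum of \<open>b \<odot> q\<close> and
  \<open>b \<odot> (u - q)\<close>.\<close>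

lemma sharp_if_idem:
  assumes q: "q \<in> I" "q \<odot> q = q"
  shows "sharp (unit_interval C u) q"
  unfolding sharp_def
proof (intro conjI ballI impI)
  fix b assume "b \<in> effects (unit_interval C u)"
    and "ele (unit_interval C u) b q \<and>
      ele (unit_interval C u) b (ecompl (unit_interval C u) q)"
  then have b: "b \<in> I" "b \<preceq> q" "b \<preceq> u - q"
    using q by auto
  have qq: "q \<odot> (u - q) = 0"
    using q by (simp add: sq_compl)
  have "q \<odot> b \<preceq> 0"
    using sq_mono[of q b "u - q"] b q qq by simp
  then have "q \<odot> b = 0"
    using sq_in_I[of q b] q b by (auto simp: I_iff intro: le_antisym)
  moreover have "(u - q) \<odot> b \<preceq> 0"
    using sq_mono[of "u - q" b q] b q sq_zero_sym[OF _ _ qq] by simp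
  then have "(u - q) \<odot> b = 0"
    using sq_in_I[of "u - q" b] q b by (auto simp: I_iff intro: le_antisym)
  ultimately have "b \<odot> q = 0" "b \<odot> (u - q) = 0"
    using sq_zero_sym b q by auto
  then show "b = \<zero>\<^bsub>unit_interval C u\<^esub>"
    using b q by (simp add: sq_compl)
qed (use q in simp)

text \<open>
  Continuity of the product along increasing sequences is continuity along decreasing
  ones, moved through the complement.
\<close>

lemma decreasing_limit:
  fixes x :: "nat \<Rightarrow> 'v"
  assumes x: "\<And>n. x n \<in> I" and dec: "\<And>n. x (Suc n) \<preceq> x n"
  obtains m where "is_einf (unit_interval C u) (range x) m"
    and "m \<in> I" "\<And>n. m \<preceq> x n" "\<And>b. \<lbrakk>b \<in> I; \<And>n. b \<preceq> x n\<rbrakk> \<Longrightarrow> b \<preceq> m"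
    and "\<And>b. b \<in> I \<Longrightarrow> is_einf (unit_interval C u) (range (\<lambda>n. b \<odot> x n)) (b \<odot> m)"
    and "\<And>b. \<lbrakk>b \<in> I; \<And>n. b \<parallel> x n\<rbrakk> \<Longrightarrow> b \<parallel> m"
proof -
  have rx: "range x \<subseteq> effects (unit_interval C u)" "range x \<subseteq> I"
    using x by auto
  have dec': "ele (unit_interval C u) (x (Suc n)) (x n)" for n
    using x dec by simp
  obtain m where m: "is_einf (unit_interval C u) (range x) m"
    using decreasing_inf[OF rx(1) dec'] by blast
  show thesis
  proof (rule that[OF m])
    show "is_einf (unit_interval C u) (range (\<lambda>n. b \<odot> x n)) (b \<odot> m)" if "b \<in> I" for b
      using seq_inf[OF rx(1) dec' m] that by simp
    show "b \<parallel> m" if "b \<in> I" "\<And>n. b \<parallel> x n" for b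
      using commutes_inf[OF rx(1) dec' m] that by (simp add: commutes_iff)
  qed (use m in \<open>auto simp: is_einf_unit_interval[OF rx(2)]\<close>)
qed

lemma increasing_limit:
  fixes x :: "nat \<Rightarrow> 'v"
  assumes x: "\<And>n. x n \<in> I" and inc: "\<And>n. x n \<preceq> x (Suc n)"
  obtains m where "m \<in> I" "\<And>n. x n \<preceq> m" "\<And>b. \<lbrakk>b \<in> I; \<And>n. x n \<preceq> b\<rbrakk> \<Longrightarrow> m \<preceq> b"
    and "\<And>b c. \<lbrakk>b \<in> I; c \<in> I; \<And>n. b \<odot> x n \<preceq> c\<rbrakk> \<Longrightarrow> b \<odot> m \<preceq> c"
    and "\<And>b. \<lbrakk>b \<in> I; \<And>n. b \<parallel> x n\<rbrakk> \<Longrightarrow> b \<parallel> m"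
proof -
  define z where "z n = u - x n" for n
  have z: "z n \<in> I" "z (Suc n) \<preceq> z n" for n
    using x inc by (simp_all add: z_def)
  obtain k where k: "k \<in> I" "\<And>n. k \<preceq> z n" "\<And>b. \<lbrakk>b \<in> I; \<And>n. b \<preceq> z n\<rbrakk> \<Longrightarrow> b \<preceq> k"
    "\<And>b. b \<in> I \<Longrightarrow> is_einf (unit_interval C u) (range (\<lambda>n. b \<odot> z n)) (b \<odot> k)"
    "\<And>b. \<lbrakk>b \<in> I; \<And>n. b \<parallel> z n\<rbrakk> \<Longrightarrow> b \<parallel> k"
    by (rule decreasing_limit[of z]) (use z in auto)
  show thesis
  proof (rule that[of "u - k"])
    show "u - k \<in> I" using k by simp
    show "x n \<preceq> u - k" for n
      using k(2)[of n] by (simp add: z_def le_diff_comm[of "x n"])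
    show "u - k \<preceq> b" if "b \<in> I" "\<And>n. x n \<preceq> b" for b
      using that k(3)[of "u - b"] by (simp add: z_def diff_le_comm[of u k])
    show "b \<odot> (u - k) \<preceq> c" if b: "b \<in> I" and "c \<in> I" and le: "\<And>n. b \<odot> x n \<preceq> c" for b c
    proof -
      have bz: "b \<odot> z n = b - b \<odot> x n" for n
        using b x[of n] by (simp add: z_def sq_compl)
      \<comment> \<open>The bound \<open>c\<close> cannot be used directly: infima are tested only
        against members of \<open>I\<close>, and \<open>b - c\<close> may fall outside. The least
        upper bound \<open>c'\<close> of the \<open>b \<odot> x n\<close> is below \<open>b\<close>,
        so \<open>b - c'\<close> is an admissible lower bound of the
        \<open>b \<odot> z n\<close>.\<close>
      obtain k' where k': "k' \<in> I" "\<And>n. k' \<preceq> u - b \<odot> x n"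
        "\<And>d. \<lbrakk>d \<in> I; \<And>n. d \<preceq> u - b \<odot> x n\<rbrakk> \<Longrightarrow> d \<preceq> k'"
        by (rule decreasing_limit[of "\<lambda>n. u - b \<odot> x n"]) (use b x inc sq_mono in auto)
      define c' where "c' = u - k'"
      have upper: "b \<odot> x n \<preceq> c'" for n
        using k'(2)[of n] by (simp add: c'_def le_diff_comm[of "b \<odot> x n"])
      have least: "c' \<preceq> d" if "d \<in> I" "\<And>n. b \<odot> x n \<preceq> d" for d
        using that k'(3)[of "u - d"] by (simp add: c'_def diff_le_comm[of u k'])
      have "c' \<preceq> b" using least b x sq_le_left by blast
      then have "b - c' \<in> I"
        using b k' by (intro diff_in_I) (auto simp: c'_def)
      moreover have "b - c' \<preceq> b \<odot> z n" for n
        using upper by (simp add: bz)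
      moreover have "range (\<lambda>n. b \<odot> z n) \<subseteq> I"
        using b z by auto
      ultimately have "b - c' \<preceq> b \<odot> k"
        using k(4)[OF b] by (simp add: is_einf_unit_interval)
      then have "b - b \<odot> k \<preceq> c'"
        by (simp add: diff_le_comm[of b c'])
      also have "c' \<preceq> c" using least that by blast
      finally show ?thesis
        using b k by (simp add: sq_compl)
    qed
    show "b \<parallel> u - k" if "b \<in> I" "\<And>n. b \<parallel> x n" for b
      using that k comm_compl x by (simp add: z_def)
  qed
qed


text \<open>The bicommutant; the product restricts to a commutative one on it.\<close>

definition K :: "'v \<Rightarrow> 'v set" where
  "K a = {x \<in> I. \<forall>b\<in>I. b \<parallel> a \<longrightarrow> b \<parallel> x}"

lemma K_in_I: "x \<in> K a \<Longrightarrow> x \<in> I"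
  by (simp add: K_def)

lemma K_self: "a \<in> I \<Longrightarrow> a \<in> K a"
  by (simp add: K_def)

lemma K_commD: "\<lbrakk>x \<in> K a; b \<in> I; b \<parallel> a\<rbrakk> \<Longrightarrow> b \<parallel> x"
  by (simp add: K_def)

text \<open>Keeps an iteration inside the bicommutant of its starting point when each step only
  lands in that of the previous term.\<close>

lemma K_trans: "\<lbrakk>x \<in> K b; b \<in> K a\<rbrakk> \<Longrightarrow> x \<in> K a"
  by (simp add: K_def)

text \<open>Bicommutation is used twice: \<open>a\<close> commutes with itself, so \<open>x\<close>
  commutes with \<open>a\<close>; therefore \<open>x\<close> commutes with \<open>y\<close>.\<close>

lemma K_comm:
  assumes "a \<in> I" "x \<in> K a" "y \<in> K a"
  shows "x \<odot> y = y \<odot> x"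
proof -
  have "x \<parallel> a" using assms K_commD[of x a a] comm_sym by simp
  then show ?thesis using assms K_commD[of y a x] K_in_I by (simp add: comm_def)
qed

lemma K_zero: "0 \<in> K a"
  by (simp add: K_def comm_def)

lemma K_one: "u \<in> K a"
  by (simp add: K_def comm_one)

lemma K_sq: "\<lbrakk>x \<in> K a; y \<in> K a\<rbrakk> \<Longrightarrow> x \<odot> y \<in> K a"
  by (simp add: K_def comm_sq)

lemma K_compl: "x \<in> K a \<Longrightarrow> u - x \<in> K a"
  by (simp add: K_def comm_compl)

lemma K_diff: "\<lbrakk>x \<in> K a; y \<in> K a; y \<preceq> x\<rbrakk> \<Longrightarrow> x - y \<in> K a"
  by (simp add: K_def comm_diff diff_in_I)

lemma add_in_I: "\<lbrakk>x \<in> I; y \<in> I; x + y \<preceq> u\<rbrakk> \<Longrightarrow> x + y \<in> I"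
  using le_add_mono[of 0 x 0 y] by (simp add: I_iff)

lemma K_add: "\<lbrakk>x \<in> K a; y \<in> K a; x + y \<preceq> u\<rbrakk> \<Longrightarrow> x + y \<in> K a"
  by (simp add: K_def comm_add add_in_I)

text \<open>The product is monotone in its right factor; commutativity on \<open>K a\<close> gives
  the left factor too.\<close>

lemma K_mono:
  assumes "a \<in> I" "x \<in> K a" "y \<in> K a" "v \<in> K a" "w \<in> K a" "x \<preceq> y" "v \<preceq> w"
  shows "x \<odot> v \<preceq> y \<odot> w"
proof -
  have "x \<odot> v \<preceq> x \<odot> w" using assms K_in_I sq_mono by blast
  also have "x \<odot> w = w \<odot> x" using assms K_comm by blast
  also have "w \<odot> x \<preceq> w \<odot> y" using assms K_in_I sq_mono by blast
  also have "w \<odot> y = y \<odot> w" using assms K_comm by blast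
  finally show ?thesis .
qed

text \<open>
  The solution \<open>w\<close> of \<open>w = a(1 - a) + w\<^sup>2\<close> found here is the meet of \<open>a\<close> and \<open>1 - a\<close> in the
  commutative algebra \<open>K a\<close>: the equation says that \<open>a - w\<close> and \<open>(1 - a) - w\<close> are orthogonal.
\<close>

lemma meet_compl:
  assumes a: "a \<in> I"
  obtains w where "w \<in> K a" "w \<preceq> a" "w \<preceq> u - a" "w = a \<odot> (u - a) + w \<odot> w"
proof -
  let ?b = "u - a" and ?t = "a \<odot> (u - a)"
  have aK: "a \<in> K a" "?b \<in> K a" and tK: "?t \<in> K a"
    using a by (auto intro: K_self K_compl K_sq)
  have [simp]: "?b \<in> I" using a by simp
  have t_comm: "?t = ?b \<odot> a" using K_comm[OF a aK] .
  have "?b \<odot> ?b = ?b - ?b \<odot> a" using a by (simp add: sq_compl)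
  then have aa: "a \<odot> a + ?t = a" "?b \<odot> ?b + ?t = ?b"
    using a by (simp add: sq_compl, simp only: t_comm diff_add_cancel)
  \<comment> \<open>By \<open>aa\<close>, both \<open>a\<close> and \<open>?b\<close> are fixed
    points of the map sending \<open>v\<close> to \<open>?t + v \<odot> v\<close>. As the map is
    monotone on \<open>K a\<close>, it preserves being below both.\<close>
  have step: "?t + v \<odot> v \<in> K a \<and> ?t + v \<odot> v \<preceq> a \<and> ?t + v \<odot> v \<preceq> ?b"
    if "v \<in> K a" "v \<preceq> a" "v \<preceq> ?b" for v
  proof -
    have "v \<odot> v \<preceq> a \<odot> a" "v \<odot> v \<preceq> ?b \<odot> ?b"
      using K_mono a aK that by blast+
    then have "?t + v \<odot> v \<preceq> a" "?t + v \<odot> v \<preceq> ?b"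
      using le_add_mono[OF le_refl[of ?t]] aa by (metis add.commute)+
    moreover from this have "?t + v \<odot> v \<preceq> u"
      using a le_trans by (auto simp: I_iff)
    ultimately show ?thesis
      using that tK by (auto intro: K_add K_sq)
  qed
  define x where "x n = ((\<lambda>v. ?t + v \<odot> v) ^^ n) 0" for n
  have x0: "x 0 = 0" and xSuc: "x (Suc n) = ?t + x n \<odot> x n" for n
    by (simp_all add: x_def)
  have x: "x n \<in> K a \<and> x n \<preceq> a \<and> x n \<preceq> ?b" for n
    by (induction n) (use a step K_zero in \<open>auto simp: x0 xSuc I_iff\<close>)
  then have xK: "x n \<in> K a" and xI: "x n \<in> I" for n
    using K_in_I by auto
  have xinc: "x n \<preceq> x (Suc n)" for n
  proof (induction n)
    case 0
    then show ?case using xI[of 1] by (simp add: x0 I_iff)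
  next
    case (Suc n)
    have "x n \<odot> x n \<preceq> x (Suc n) \<odot> x (Suc n)"
      using K_mono[OF a xK xK xK xK Suc Suc] .
    then show ?case using xSuc[of n] xSuc[of "Suc n"] by (metis le_add_left_iff)
  qed
  have xmono: "m \<le> n \<Longrightarrow> x m \<preceq> x n" for m n
    by (induction rule: dec_induct) (auto intro: le_trans xinc)
  obtain w where w: "w \<in> I" "\<And>n. x n \<preceq> w" "\<And>b. \<lbrakk>b \<in> I; \<And>n. x n \<preceq> b\<rbrakk> \<Longrightarrow> w \<preceq> b"
    "\<And>b c. \<lbrakk>b \<in> I; c \<in> I; \<And>n. b \<odot> x n \<preceq> c\<rbrakk> \<Longrightarrow> b \<odot> w \<preceq> c"
    "\<And>b. \<lbrakk>b \<in> I; \<And>n. b \<parallel> x n\<rbrakk> \<Longrightarrow> b \<parallel> w"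
    using increasing_limit[of x, OF xI xinc] by metis
  have wK: "w \<in> K a"
    using w(1,5) K_commD[OF xK] by (simp add: K_def)
  have wa: "w \<preceq> a" "w \<preceq> ?b"
    using w(3) x a by auto
  note r = step[OF wK wa]
  \<comment> \<open>The right-hand side bounds every iterate, so the least upper bound
    \<open>w\<close> lies below it. The start \<open>x 0 = 0\<close> does not come from the
    recursion and is treated apart.\<close>
  have "x n \<preceq> ?t + w \<odot> w" for n
  proof (cases n)
    case 0
    then show ?thesis using r K_in_I by (auto simp: x0 I_iff)
  next
    case (Suc k)
    then show ?thesis using K_mono[OF a xK wK xK wK] w(2) by (simp add: xSuc)
  qed
  then have "w \<preceq> ?t + w \<odot> w"
    using w(3) r K_in_I by blast
  moreover have "?t + w \<odot> w \<preceq> w"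
  proof -
    have "?t \<preceq> w" using w(2)[of 1] a by (simp add: xSuc x0)
    then have tI: "w - ?t \<in> I" using w(1) tK K_in_I by (intro diff_in_I) auto
    \<comment> \<open>Continuity is available in one right factor at a time. Hence the indices are
      kept independent: first \<open>m\<close> goes to the limit, then the factors are swapped and
      \<open>n\<close> does.\<close>
    have "x n \<odot> x m \<preceq> w - ?t" for n m
    proof -
      have "x n \<odot> x m \<preceq> x (max n m) \<odot> x (max n m)"
        by (intro K_mono[OF a] xK xmono) auto
      also have "\<dots> \<preceq> w - ?t"
        using w(2)[of "Suc (max n m)"] by (simp add: xSuc le_diff_eq add.commute)
      finally show ?thesis .
    qed
    then have "x n \<odot> w \<preceq> w - ?t" for n
      using w(4) xI tI by blast
    then have "w \<odot> x n \<preceq> w - ?t" for n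
      using K_comm[OF a wK xK] by simp
    then have "w \<odot> w \<preceq> w - ?t"
      using w(1,4) tI by blast
    then show ?thesis by (simp add: le_diff_eq add.commute)
  qed
  ultimately have "w = ?t + w \<odot> w" by (rule le_antisym)
  with wK wa show thesis by (rule that)
qed

text \<open>\<open>q\<close> is the projection onto the kernel of \<open>c\<close>: the powers of
  \<open>u - c\<close> decrease to it. An effect orthogonal to \<open>c\<close> is fixed by
  multiplication with every power, hence with the infimum.\<close>

lemma kernel_projection:
  assumes a: "a \<in> I" and c: "c \<in> K a"
  obtains q where "q \<in> K a" "q \<odot> q = q" "q \<odot> c = 0" "\<And>d. \<lbrakk>d \<in> K a; c \<odot> d = 0\<rbrakk> \<Longrightarrow> d \<odot> q = d"
proof -
  have cI: "c \<in> I" using c K_in_I by blast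
  define e where "e = u - c"
  have eK: "e \<in> K a" and eI: "e \<in> I"
    using c cI by (auto simp: e_def intro: K_compl)
  define x where "x n = ((\<odot>) e ^^ n) u" for n
  have x0: "x 0 = u" and xSuc: "x (Suc n) = e \<odot> x n" for n
    by (simp_all add: x_def)
  have xK: "x n \<in> K a" for n
    by (induction n) (auto simp: x0 xSuc intro: K_one K_sq eK)
  then have xI: "x n \<in> I" for n using K_in_I by blast
  have xdec: "x (Suc n) \<preceq> x n" for n
  proof -
    have "x (Suc n) = x n \<odot> e" using K_comm[OF a eK xK] by (simp add: xSuc)
    then show ?thesis using sq_le_left xI eI by simp
  qed
  obtain q where q: "is_einf (unit_interval C u) (range x) q" "q \<in> I" "\<And>n. q \<preceq> x n"
    "\<And>b. b \<in> I \<Longrightarrow> is_einf (unit_interval C u) (range (\<lambda>n. b \<odot> x n)) (b \<odot> q)"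
    "\<And>b. \<lbrakk>b \<in> I; \<And>n. b \<parallel> x n\<rbrakk> \<Longrightarrow> b \<parallel> q" "\<And>b. \<lbrakk>b \<in> I; \<And>n. b \<preceq> x n\<rbrakk> \<Longrightarrow> b \<preceq> q"
    using decreasing_limit[of x, OF xI xdec] by metis
  have qK: "q \<in> K a"
    using q(2,5) K_commD[OF xK] by (simp add: K_def)
  have "e \<odot> q = q"
  proof (rule le_antisym)
    show "e \<odot> q \<preceq> q"
      using sq_le_left[of q e] K_comm[OF a eK qK] eI q(2) by simp
    \<comment> \<open>By continuity \<open>e \<odot> q\<close> is the infimum of the shifted
      sequence \<open>x (Suc n)\<close>, of which \<open>q\<close> is a lower bound.\<close>
    have "range (\<lambda>n. e \<odot> x n) \<subseteq> I" using eI xI by auto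
    then show "q \<preceq> e \<odot> q"
      using q(4)[OF eI] q(2,3) by (simp add: is_einf_unit_interval flip: xSuc)
  qed
  then have qe: "q \<odot> e = q" using K_comm[OF a eK qK] by simp
  \<comment> \<open>If \<open>d\<close> absorbs \<open>e\<close>, then \<open>d \<odot> x n\<close>
    is constantly \<open>d\<close>, and its infimum is \<open>d \<odot> q\<close>. Taking
    \<open>d\<close> to be \<open>q\<close> itself gives idempotence.\<close>
  have fix_q: "d \<odot> q = d" if d: "d \<in> K a" "d \<odot> e = d" for d
  proof -
    have dI: "d \<in> I" using d K_in_I by blast
    have "d \<parallel> e" using K_comm[OF a d(1) eK] by (simp add: comm_def)
    then have "d \<odot> x n = d" for n
      by (induction n) (use d dI eI xI in \<open>simp_all add: x0 xSuc sq_assoc\<close>)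
    then have "is_einf (unit_interval C u) {d} (d \<odot> q)"
      using q(4)[OF dI] by simp
    then show ?thesis
      using dI by (auto simp: is_einf_unit_interval intro: le_antisym)
  qed
  show thesis
  proof (rule that[OF qK])
    show "q \<odot> q = q" using fix_q[OF qK qe] .
    show "q \<odot> c = 0" using qe cI q(2) by (simp add: e_def sq_compl)
    show "d \<odot> q = d" if "d \<in> K a" "c \<odot> d = 0" for d
    proof (rule fix_q[OF that(1)])
      have "d \<in> I" using that K_in_I by blast
      then show "d \<odot> e = d"
        using sq_zero_sym[OF cI _ that(2)] cI by (simp add: e_def sq_compl)
    qed
  qed
qed

text \<open>The witness \<open>p\<close> is the spectral projection of \<open>a\<close> for \<open>a > 1/2\<close>.\<close>

lemma binary_digit:
  assumes a: "a \<in> I"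
  obtains p where "p \<in> K a" "p \<odot> p = p" "2 *\<^sub>R a - p \<in> K a"
proof -
  obtain w where wK: "w \<in> K a" and wa: "w \<preceq> a" "w \<preceq> u - a" and w: "w = a \<odot> (u - a) + w \<odot> w"
    using meet_compl[OF a] .
  \<comment> \<open>\<open>c\<close> and \<open>d\<close> will be the positive and negative parts of
    \<open>2 *\<^sub>R a - u\<close>: their difference is this element, and their product is shown
    to vanish.\<close>
  define c where "c = a - w"
  define d where "d = (u - a) - w"
  have aK: "a \<in> K a" "u - a \<in> K a" using a by (auto intro: K_self K_compl)
  have cK: "c \<in> K a" and dK: "d \<in> K a"
    using aK wK wa by (auto simp: c_def d_def intro: K_diff)
  note inI = K_in_I[OF aK(2)] K_in_I[OF wK] K_in_I[OF cK] K_in_I[OF dK]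
  \<comment> \<open>Expanding, the mixed terms \<open>a \<odot> w\<close> cancel and
    \<open>a \<odot> (u - a) - w + w \<odot> w\<close> remains, which is zero by the equation for
    \<open>w\<close>.\<close>
  have "c \<odot> d = d \<odot> c" using K_comm[OF a cK dK] .
  also have "\<dots> = d \<odot> a - d \<odot> w" using sq_diff inI a wa by (simp add: c_def)
  also have "d \<odot> a = a \<odot> d" using K_comm[OF a aK(1) dK] by simp
  also have "a \<odot> d = a \<odot> (u - a) - a \<odot> w"
    unfolding d_def using sq_diff inI a wa by simp
  also have "d \<odot> w = w \<odot> d" using K_comm[OF a wK dK] by simp
  also have "w \<odot> d = w \<odot> (u - a) - w \<odot> w"
    unfolding d_def using sq_diff inI a wa by simp
  also have "w \<odot> (u - a) = w - w \<odot> a"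
    using sq_compl inI a by simp
  also have "w \<odot> a = a \<odot> w" using K_comm[OF a wK aK(1)] .
  finally have cd: "c \<odot> d = 0" using w by (simp add: algebra_simps)
  obtain q where q: "q \<in> K a" "q \<odot> q = q" "q \<odot> c = 0" "d \<odot> q = d"
    using kernel_projection[OF a cK] dK cd by metis
  have qI: "q \<in> I" using q K_in_I by blast
  \<comment> \<open>Multiplying this decomposition by \<open>q\<close> kills \<open>c\<close>, keeps
    \<open>d\<close> and gives \<open>q = d + 2wq\<close>. Since \<open>2a - u = c - d\<close>, it
    follows that \<open>2a - (u - q) = c + 2wq\<close>, a positive element below
    \<open>c + d + 2w = u\<close>. The bounds come first because the product is additive only on
    defined sums.\<close>
  have sum: "u = (c + d) + (w + w)" by (simp add: c_def d_def)
  have "0 \<preceq> c + d" "0 \<preceq> w + w"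
    using inI le_add_mono[of 0 c 0 d] le_add_mono[of 0 w 0 w] by (simp_all add: I_iff)
  then have le: "c + d \<preceq> u" "w + w \<preceq> u"
    using sum le_add_same by (metis add.commute)+
  then have "c + d \<in> I" "w + w \<in> I"
    using inI by (auto intro: add_in_I)
  then have "q \<odot> u = q \<odot> (c + d) + q \<odot> (w + w)"
    using sq_add[of q "c + d" "w + w"] qI sum by simp
  also have "\<dots> = d + (q \<odot> w + q \<odot> w)"
    using sq_add qI inI le q(3,4) K_comm[OF a q(1) dK] by simp
  finally have "q = d + (q \<odot> w + q \<odot> w)" using qI by simp
  moreover have "q \<odot> w = w \<odot> q" using K_comm[OF a q(1) wK] .
  ultimately have q_eq: "q = d + (w \<odot> q + w \<odot> q)" by simp
  have eq: "2 *\<^sub>R a - (u - q) = c + (w \<odot> q + w \<odot> q)"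
    by (subst q_eq) (simp add: c_def d_def scaleR_2)
  have wq: "w \<odot> q \<preceq> w" using sq_le_left inI qI by blast
  then have "c + (w \<odot> q + w \<odot> q) \<preceq> (c + d) + (w + w)"
    using inI by (intro le_add_mono le_add_same) (auto simp: I_iff)
  then have "c + (w \<odot> q + w \<odot> q) \<preceq> u" using sum by simp
  moreover have "w \<odot> q + w \<odot> q \<preceq> u"
    using le_add_mono[OF wq wq] le(2) le_trans by blast
  ultimately have "2 *\<^sub>R a - (u - q) \<in> K a"
    unfolding eq using cK wK q(1) by (intro K_add K_sq)
  moreover have "(u - q) \<odot> (u - q) = u - q"
  proof -
    have "q \<odot> (u - q) = 0" using qI q(2) by (simp add: sq_compl)
    then have "(u - q) \<odot> q = 0" using sq_zero_sym qI by simp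
    then show ?thesis using qI by (simp add: sq_compl)
  qed
  ultimately show thesis
    using that[of "u - q"] q(1) K_compl by blast
qed

text \<open>Each remainder \<open>r n\<close> is doubled and its digit subtracted, leaving an effect
  again. After \<open>n\<close> digits the error is \<open>(1 / 2) ^ n *\<^sub>R r n\<close>,
  bounded because \<open>r n\<close> is in \<open>I\<close>; \<open>K_trans\<close> keeps all digits
  in \<open>K a\<close>.\<close>

lemma binary_expansion:
  assumes a: "a \<in> I"
  obtains p :: "nat \<Rightarrow> 'v" where "\<And>n. p n \<in> K a" "\<And>n. p n \<odot> p n = p n"
    and "\<And>n. 0 \<preceq> a - (\<Sum>i<n. (1 / 2) ^ Suc i *\<^sub>R p i)"
    and "\<And>n. a - (\<Sum>i<n. (1 / 2) ^ Suc i *\<^sub>R p i) \<preceq> (1 / 2) ^ n *\<^sub>R u"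
proof -
  have "\<exists>p. \<forall>b\<in>I. p b \<in> K b \<and> p b \<odot> p b = p b \<and> 2 *\<^sub>R b - p b \<in> K b"
    using binary_digit by (intro bchoice) metis
  then obtain d where d: "\<And>b. b \<in> I \<Longrightarrow> d b \<in> K b" "\<And>b. b \<in> I \<Longrightarrow> d b \<odot> d b = d b"
    "\<And>b. b \<in> I \<Longrightarrow> 2 *\<^sub>R b - d b \<in> K b"
    by blast
  define r where "r n = ((\<lambda>b. 2 *\<^sub>R b - d b) ^^ n) a" for n
  have r0: "r 0 = a" and rSuc: "r (Suc n) = 2 *\<^sub>R r n - d (r n)" for n
    by (simp_all add: r_def)
  have rK: "r n \<in> K a" for n
  proof (induction n)
    case (Suc n)
    then show ?case using d(3) K_in_I K_trans by (metis rSuc)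
  qed (simp add: r0 a K_self)
  then have rI: "r n \<in> I" for n using K_in_I by blast
  have eq: "a - (\<Sum>i<n. (1 / 2) ^ Suc i *\<^sub>R d (r i)) = (1 / 2) ^ n *\<^sub>R r n" for n
  proof (induction n)
    case (Suc n)
    have "a - (\<Sum>i<Suc n. (1 / 2) ^ Suc i *\<^sub>R d (r i))
        = (1 / 2) ^ n *\<^sub>R r n - (1 / 2) ^ Suc n *\<^sub>R d (r n)"
      using Suc by (simp add: algebra_simps)
    also have "\<dots> = (1 / 2) ^ Suc n *\<^sub>R r (Suc n)"
      by (simp add: rSuc scaleR_diff_right)
    finally show ?case .
  qed (simp add: r0)
  show thesis
  proof (rule that[of "\<lambda>n. d (r n)"])
    show "d (r n) \<in> K a" "d (r n) \<odot> d (r n) = d (r n)" for n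
      using d rI rK K_trans by blast+
    fix n
    have "0 \<preceq> r n" "r n \<preceq> u" using rI by (simp_all add: I_iff)
    then show "0 \<preceq> a - (\<Sum>i<n. (1 / 2) ^ Suc i *\<^sub>R d (r i))"
      and "a - (\<Sum>i<n. (1 / 2) ^ Suc i *\<^sub>R d (r i)) \<preceq> (1 / 2) ^ n *\<^sub>R u"
      unfolding eq by (simp_all add: scale_nonneg scale_mono)
  qed
qed

section \<open>Refinement of commuting sharp effects to orthogonal ones\<close>

lemma K_assoc:
  assumes "a \<in> I" "x \<in> K a" "y \<in> K a" "z \<in> K a"
  shows "x \<odot> (y \<odot> z) = x \<odot> y \<odot> z"
  using assms sq_assoc K_in_I K_comm comm_def by blast

lemma K_left_comm:
  assumes "a \<in> I" "x \<in> K a" "y \<in> K a" "z \<in> K a"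
  shows "x \<odot> (y \<odot> z) = y \<odot> (x \<odot> z)"
  using assms K_assoc K_comm[of a x y] by metis

lemma K_sq_sq:
  assumes "a \<in> I" "x \<in> K a" "y \<in> K a" "z \<in> K a" "w \<in> K a"
  shows "(x \<odot> y) \<odot> (z \<odot> w) = (x \<odot> z) \<odot> (y \<odot> w)"
proof -
  have "(x \<odot> y) \<odot> (z \<odot> w) = x \<odot> (y \<odot> (z \<odot> w))"
    using assms by (intro K_assoc[symmetric] K_sq)
  also have "\<dots> = x \<odot> (z \<odot> (y \<odot> w))"
    using assms K_left_comm[of a y z w] by simp
  also have "\<dots> = (x \<odot> z) \<odot> (y \<odot> w)"
    using assms by (intro K_assoc K_sq)
  finally show ?thesis .
qed

text \<open>By the interchange law either vanishing pair suffices. Two refined pieces are orthogonal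
  because they lie on opposite sides of \<open>p\<close>, or because they refine orthogonal
  pieces.\<close>

lemma K_orthogonal:
  assumes "a \<in> I" "x \<in> K a" "y \<in> K a" "z \<in> K a" "w \<in> K a" "x \<odot> z = 0 \<or> y \<odot> w = 0"
  shows "(x \<odot> y) \<odot> (z \<odot> w) = 0"
proof -
  have "x \<odot> z \<in> I" "y \<odot> w \<in> I" using assms K_sq K_in_I by blast+
  then show ?thesis using K_sq_sq[OF assms(1-5)] assms(6) by auto
qed

lemma K_split:
  assumes "a \<in> I" "p \<in> K a" "q \<in> K a"
  shows "p \<odot> q + (u - p) \<odot> q = q"
  using assms K_comm[of a p q] K_comm[of a "u - p" q] K_compl K_in_I by (simp add: sq_compl)

lemma sq_sum_list:
  assumes "p \<in> I" "set qs \<subseteq> I" "sum_list qs \<preceq> u"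
  shows "sum_list (map ((\<odot>) p) qs) = p \<odot> sum_list qs"
  using assms
proof (induction qs)
  case (Cons q qs)
  have "0 \<preceq> sum_list qs" using Cons.prems by (intro sum_list_nonneg_cone) (auto simp: I_iff subset_iff)
  moreover have "sum_list qs \<preceq> q + sum_list qs"
    using Cons.prems by (simp add: cone_le_def I_iff)
  then have "sum_list qs \<preceq> u"
    using Cons.prems(3) le_trans by simp
  ultimately show ?case
    using Cons by (simp add: sq_add I_iff)
qed simp

text \<open>Induction on \<open>n\<close> over weighted partitions of \<open>u\<close>. Adding
  \<open>c n *\<^sub>R p n\<close> splits each piece \<open>q\<close> by \<open>p n\<close> and its
  complement, and raises the weight by \<open>c n\<close> on the first half only. Thus a weight
  collects each \<open>c i\<close> at most once, which gives its upper bound.\<close>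

lemma refine_partition:
  assumes a: "a \<in> I" and p: "\<And>i. p i \<in> K a" "\<And>i. p i \<odot> p i = p i" and c: "\<And>i. 0 \<le> c i"
  shows "\<exists>xs. (\<forall>(l, q) \<in> set xs. 0 \<le> l \<and> l \<le> (\<Sum>i<n::nat. c i) \<and> q \<in> K a \<and> q \<odot> q = q) \<and>
    sorted_wrt (\<lambda>x y. snd x \<odot> snd y = 0) xs \<and> sum_list (map snd xs) = u \<and>
    (\<Sum>(l, q)\<leftarrow>xs. l *\<^sub>R q) = (\<Sum>i<n. c i *\<^sub>R p i)"
proof (induction n)
  case 0
  \<comment> \<open>The trivial partition has weight zero, so zero weights must be allowed until the
    refinement is finished.\<close>
  show ?case by (rule exI[of _ "[(0, u)]"]) (simp add: K_one)
next
  case (Suc n)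
  let ?B = "\<lambda>n. \<Sum>i<n. c i" and ?p = "p n" and ?c = "c n"
  obtain xs where xs: "\<And>l q. (l, q) \<in> set xs \<Longrightarrow> 0 \<le> l \<and> l \<le> ?B n \<and> q \<in> K a \<and> q \<odot> q = q"
    and orth: "sorted_wrt (\<lambda>x y. snd x \<odot> snd y = 0) xs" and sum: "sum_list (map snd xs) = u"
    and val: "(\<Sum>(l, q)\<leftarrow>xs. l *\<^sub>R q) = (\<Sum>i<n. c i *\<^sub>R p i)"
    using Suc by fast
  have xsK: "q \<in> K a" if "(l, q) \<in> set xs" for l q
    using xs that by blast
  let ?ys = "map (\<lambda>(l, q). (l + ?c, ?p \<odot> q)) xs" and ?zs = "map (\<lambda>(l, q). (l, (u - ?p) \<odot> q)) xs"
  have pK: "?p \<in> K a" "u - ?p \<in> K a" using p K_compl by auto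
  have pI: "?p \<in> I" "u - ?p \<in> I" using pK K_in_I by auto
  have p0: "?p \<odot> (u - ?p) = 0" using pI p(2) by (simp add: sq_compl)
  have idem: "(u - ?p) \<odot> (u - ?p) = u - ?p"
    using sq_zero_sym[OF pI p0] pI by (simp add: sq_compl)
  \<comment> \<open>Any effect is the sum of its products with the pieces. For \<open>?p\<close>
    this recovers the new summand; for \<open>?p\<close> and its complement together it shows that
    the new pieces again add up to \<open>u\<close>.\<close>
  have part: "sum_list (map (\<lambda>x. v \<odot> snd x) xs) = v" if "v \<in> I" for v
  proof -
    have "set (map snd xs) \<subseteq> I" using K_in_I[OF xsK] by fastforce
    then have "sum_list (map ((\<odot>) v) (map snd xs)) = v \<odot> u"
      using sq_sum_list[of v "map snd xs"] that sum by simp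
    then show ?thesis using that by (simp add: comp_def)
  qed
  \<comment> \<open>Stated for lists with entries from \<open>xs\<close>, so that the induction
    varies the list while the facts about \<open>xs\<close> stay fixed.\<close>
  have "(\<Sum>(l, q)\<leftarrow>vs. (l + ?c) *\<^sub>R (?p \<odot> q)) + (\<Sum>(l, q)\<leftarrow>vs. l *\<^sub>R ((u - ?p) \<odot> q))
      = (\<Sum>(l, q)\<leftarrow>vs. l *\<^sub>R q) + ?c *\<^sub>R sum_list (map (\<lambda>x. ?p \<odot> snd x) vs)"
    if "set vs \<subseteq> set xs" for vs
    using that
  proof (induction vs)
    case (Cons v vs)
    obtain l q where v: "v = (l, q)" by force
    have "l *\<^sub>R q = l *\<^sub>R (?p \<odot> q) + l *\<^sub>R ((u - ?p) \<odot> q)"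
      using K_split[OF a pK(1), of q] xsK[of l q] Cons.prems v
      by (simp flip: scaleR_add_right)
    then show ?case using Cons v by (simp add: algebra_simps)
  qed simp
  from this[of xs] have "(\<Sum>(l, q)\<leftarrow>?ys @ ?zs. l *\<^sub>R q) = (\<Sum>i<Suc n. c i *\<^sub>R p i)"
    using part[OF pI(1)] val by (simp add: comp_def case_prod_unfold)
  moreover have "sum_list (map snd (?ys @ ?zs)) = u"
    using part[OF pI(1)] part[OF pI(2)] by (simp add: comp_def case_prod_unfold)
  \<comment> \<open>Within \<open>?ys\<close> and within \<open>?zs\<close> orthogonality is
    inherited from \<open>xs\<close>; across the two blocks it comes from \<open>p0\<close>.\<close>
  moreover have "sorted_wrt (\<lambda>x y. snd x \<odot> snd y = 0) (?ys @ ?zs)"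
  proof -
    have "snd x \<in> K a" if "x \<in> set xs" for x
      using xsK that by (metis prod.collapse)
    then show ?thesis
      using orth a pK p0
      by (auto simp: sorted_wrt_append sorted_wrt_map case_prod_unfold
          intro!: K_orthogonal elim!: sorted_wrt_mono_rel[rotated])
  qed
  moreover have "0 \<le> l \<and> l \<le> ?B (Suc n) \<and> q \<in> K a \<and> q \<odot> q = q" if "(l, q) \<in> set (?ys @ ?zs)" for l q
  proof -
    \<comment> \<open>Both halves at once: \<open>v\<close> stands for \<open>?p\<close> or for its
      complement.\<close>
    have *: "0 \<le> l \<and> l \<le> ?B (Suc n) \<and> q \<in> K a \<and> q \<odot> q = q"
      if q': "(l', q') \<in> set xs" "l = l' \<or> l = l' + ?c" "q = v \<odot> q'"
        and v: "v \<in> K a" "v \<odot> v = v" for l' q' v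
    proof -
      have "q \<odot> q = q"
        using K_sq_sq[OF a v(1) xsK[OF q'(1)] v(1) xsK[OF q'(1)]] xs[OF q'(1)] v(2) q'(3) by simp
      moreover have "q \<in> K a"
        using K_sq[OF v(1) xsK[OF q'(1)]] q'(3) by simp
      ultimately show ?thesis
        using xs[OF q'(1)] q'(2) c[of n] by auto
    qed
    show ?thesis
      using that *[OF _ _ _ pK(1) p(2)] *[OF _ _ _ pK(2) idem] by auto
  qed
  ultimately show ?case by blast
qed

text \<open>The partial sums of the binary expansion increase because the digits are positive; each
  of them is rewritten by \<open>refine_partition\<close>.\<close>

lemma simple_approximation:
  assumes a: "a \<in> I"
  obtains s :: "nat \<Rightarrow> 'v" where "\<And>n. s n \<in> I" "\<And>n. s n \<preceq> s (Suc n)"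
    and "\<And>n. s n \<preceq> a" "\<And>n. a - s n \<preceq> (1 / 2) ^ n *\<^sub>R u"
    and "\<And>n. \<exists>xs. (\<forall>(l, q) \<in> set xs. 0 < l \<and> l \<le> 1 \<and> q \<in> I \<and> sharp (unit_interval C u) q \<and> q \<parallel> a) \<and>
      sorted_wrt (\<lambda>x y. snd x \<odot> snd y = 0) xs \<and>
      esum_list (unit_interval C u) (map (\<lambda>(l, q). l *\<^sub>R q) xs) = Some (s n)"
proof -
  obtain p :: "nat \<Rightarrow> 'v" where p: "\<And>n. p n \<in> K a" "\<And>n. p n \<odot> p n = p n"
    and p_low: "\<And>n. 0 \<preceq> a - (\<Sum>i<n. (1 / 2) ^ Suc i *\<^sub>R p i)"
    and p_up: "\<And>n. a - (\<Sum>i<n. (1 / 2) ^ Suc i *\<^sub>R p i) \<preceq> (1 / 2) ^ n *\<^sub>R u"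
    by (rule binary_expansion[OF a], rule that)
  define s where "s n = (\<Sum>i<n. (1 / 2) ^ Suc i *\<^sub>R p i)" for n
  have s0: "s 0 = 0" and sSuc: "s (Suc n) = s n + (1 / 2) ^ Suc n *\<^sub>R p n" for n
    by (simp_all add: s_def)
  have inc: "s n \<preceq> s (Suc n)" for n
    unfolding sSuc using K_in_I[OF p(1)] by (intro le_add_same scale_nonneg) (auto simp: I_iff)
  have nonneg: "0 \<preceq> s n" for n
  proof (induction n)
    case (Suc n)
    then show ?case using inc[of n] by (rule le_trans)
  qed (simp add: s0)
  have sa: "s n \<preceq> a" for n using p_low[of n] by (simp add: s_def)
  have sI: "s n \<in> I" for n using I_subinterval[OF a nonneg sa] .
  show thesis
  proof (rule that[of s, OF sI inc sa])
    show "a - s n \<preceq> (1 / 2) ^ n *\<^sub>R u" for n using p_up by (simp add: s_def)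
    fix n
    \<comment> \<open>The geometric sum bounds every weight of the partition by 1.\<close>
    have "(\<Sum>i<n. (1 / 2 :: real) ^ Suc i) = 1 - (1 / 2) ^ n"
      by (induction n) (auto simp: field_simps)
    then have B: "(\<Sum>i<n. (1 / 2 :: real) ^ Suc i) \<le> 1" by simp
    obtain xs where
      xs: "\<And>l q. (l, q) \<in> set xs \<Longrightarrow> 0 \<le> l \<and> l \<le> (\<Sum>i<n. (1 / 2) ^ Suc i) \<and> q \<in> K a \<and> q \<odot> q = q"
      and orth: "sorted_wrt (\<lambda>x y. snd x \<odot> snd y = 0) xs"
      and val: "(\<Sum>(l, q)\<leftarrow>xs. l *\<^sub>R q) = (\<Sum>i<n. (1 / 2) ^ Suc i *\<^sub>R p i)"
      using refine_partition[of a p "\<lambda>i. (1 / 2) ^ Suc i" n, OF a p] by fastforce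
    \<comment> \<open>Pieces of weight zero are dropped: the weights must be strictly positive, and
      the sum does not change.\<close>
    let ?xs = "filter (\<lambda>x. 0 < fst x) xs"
    have xs': "0 < l \<and> l \<le> 1 \<and> q \<in> I \<and> sharp (unit_interval C u) q \<and> q \<parallel> a"
      if "(l, q) \<in> set ?xs" for l q
      using that xs[of l q] B K_in_I sharp_if_idem K_commD[of q a a] a comm_sym by auto
    have "(\<Sum>(l, q)\<leftarrow>?xs. l *\<^sub>R q) = (\<Sum>(l, q)\<leftarrow>xs. l *\<^sub>R q)"
      using xs by (intro sum_list_map_filter) force
    then have sum: "(\<Sum>(l, q)\<leftarrow>?xs. l *\<^sub>R q) = s n"
      using val by (simp add: s_def)
    have "esum_list (unit_interval C u) (map (\<lambda>(l, q). l *\<^sub>R q) ?xs) = Some (\<Sum>(l, q)\<leftarrow>?xs. l *\<^sub>R q)"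
    proof (rule esum_list_unit_interval)
      show "0 \<preceq> x" if "x \<in> set (map (\<lambda>(l, q). l *\<^sub>R q) ?xs)" for x
      proof -
        from that obtain l q where lq: "(l, q) \<in> set ?xs" "x = l *\<^sub>R q" by auto
        with xs'[OF lq(1)] show ?thesis by (simp add: scale_nonneg I_iff)
      qed
      show "(\<Sum>(l, q)\<leftarrow>?xs. l *\<^sub>R q) \<preceq> u" using sI[of n] by (simp add: sum I_iff)
    qed
    then have "esum_list (unit_interval C u) (map (\<lambda>(l, q). l *\<^sub>R q) ?xs) = Some (s n)"
      using sum by simp
    moreover have "sorted_wrt (\<lambda>x y. snd x \<odot> snd y = 0) ?xs"
      using orth by (rule sorted_wrt_filter)
    moreover have "\<forall>(l, q) \<in> set ?xs. 0 < l \<and> l \<le> 1 \<and> q \<in> I \<and> sharp (unit_interval C u) q \<and> q \<parallel> a"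
    proof
      fix x assume "x \<in> set ?xs"
      then show "case x of (l, q) \<Rightarrow>
          0 < l \<and> l \<le> 1 \<and> q \<in> I \<and> sharp (unit_interval C u) q \<and> q \<parallel> a"
        using xs'[of "fst x" "snd x"] by (simp only: prod.collapse case_prod_unfold)
    qed
    ultimately show "\<exists>xs. (\<forall>(l, q) \<in> set xs. 0 < l \<and> l \<le> 1 \<and> q \<in> I \<and>
        sharp (unit_interval C u) q \<and> q \<parallel> a) \<and>
      sorted_wrt (\<lambda>x y. snd x \<odot> snd y = 0) xs \<and>
      esum_list (unit_interval C u) (map (\<lambda>(l, q). l *\<^sub>R q) xs) = Some (s n)"
      by (intro exI[of _ ?xs] conjI)
  qed
qed

end

section \<open>The spectral theorem\<close>

text \<open>The order unit space enters through a given isomorphism \<open>\<phi>\<close>, which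
  also carries the norm. The bound \<open>l i \<le> 1\<close> keeps the scalars in the range where
  the action \<open>smul\<close> is constrained.\<close>

theorem theorem4p12:
  fixes E :: "'e effect_structure"
    and seqprod :: "'e \<Rightarrow> 'e \<Rightarrow> 'e"
    and smul :: "real \<Rightarrow> 'e \<Rightarrow> 'e"
    and C :: "'v::real_vector set" and u :: 'v
    and \<phi> :: "'e \<Rightarrow> 'v"
    and a :: 'e
  assumes "sequential_effect_space E seqprod smul"
    and "order_unit_space C u"
    and "convex_effect_iso E smul (unit_interval C u) (*\<^sub>R) \<phi>"
    and "a \<in> effects E"
  shows "\<exists>s :: nat \<Rightarrow> 'e.
    (\<forall>n. s n \<in> effects E) \<and>
    (\<forall>n. ele E (s n) (s (Suc n))) \<and>
    (\<forall>n. \<exists>(k::nat) (l :: nat \<Rightarrow> real) (p :: nat \<Rightarrow> 'e).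
       (\<forall>i<k. 0 < l i \<and> l i \<le> 1 \<and> sharp E (p i) \<and> commutes seqprod (p i) a) \<and>
       (\<forall>i<k. \<forall>j<k. i \<noteq> j \<longrightarrow> orthogonal_effects E seqprod (p i) (p j)) \<and>
       esum_list E (map (\<lambda>i. smul (l i) (p i)) [0..<k]) = Some (s n)) \<and>
    is_esup E (range s) a \<and>
    (\<lambda>n. order_unit_norm C u (\<phi> (s n) - \<phi> a)) \<longlonglongrightarrow> 0"
proof -
  interpret S: sequential_effect_space E seqprod smul by fact
  interpret V: order_unit_space C u by fact
  interpret iso: effect_algebra_iso E "unit_interval C u" \<phi>
    using assms(3) by unfold_locales (auto simp: convex_effect_iso_def)
  have smul: "\<phi> (smul r x) = r *\<^sub>R \<phi> x" if "r \<in> {0..1}" "x \<in> effects E" for r x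
    using assms(3) that by (simp add: convex_effect_iso_def)
  \<comment> \<open>The product of \<open>E\<close> read on the unit interval, where
    \<open>iso.\<psi>\<close> inverts \<open>\<phi>\<close>.\<close>
  let ?sq = "\<lambda>x y. \<phi> (seqprod (iso.\<psi> x) (iso.\<psi> y))"
  interpret SV: sigma_sequential_effect_algebra "unit_interval C u" ?sq
    by (rule iso.iso_sigma_sequential_effect_algebra) unfold_locales
  interpret V: interval_sigma_sea C u ?sq ..
  have psi_V [simp]: "iso.\<psi> x \<in> effects E" "\<phi> (iso.\<psi> x) = x" if "x \<in> V.I" for x
    using that by simp_all
  have phi_V [simp]: "\<phi> x \<in> V.I" if "x \<in> effects E" for x
    using iso.phi_closed[OF that] by simp
  obtain s where sI: "\<And>n. s n \<in> V.I" and inc: "\<And>n. cone_le C (s n) (s (Suc n))"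
    and below: "\<And>n. cone_le C (s n) (\<phi> a)"
    and close: "\<And>n. cone_le C (\<phi> a - s n) ((1 / 2) ^ n *\<^sub>R u)"
    and simple: "\<And>n. \<exists>xs. (\<forall>(l, q) \<in> set xs. 0 < l \<and> l \<le> 1 \<and> q \<in> V.I \<and>
        sharp (unit_interval C u) q \<and> V.comm q (\<phi> a)) \<and>
      sorted_wrt (\<lambda>x y. ?sq (snd x) (snd y) = 0) xs \<and>
      esum_list (unit_interval C u) (map (\<lambda>(l, q). l *\<^sub>R q) xs) = Some (s n)"
    by (rule V.simple_approximation[OF phi_V[OF assms(4)]], rule that)
  define t where "t n = iso.\<psi> (s n)" for n
  have t: "t n \<in> effects E" "\<phi> (t n) = s n" for n
    using sI by (simp_all add: t_def)
  have seq_V: "seqprod x y \<in> effects E" if "x \<in> effects E" "y \<in> effects E" for x y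
    using S.seq_closed that .
  show ?thesis
  proof (intro exI[of _ t] conjI allI)
    show "t n \<in> effects E" for n by (rule t)
    show "ele E (t n) (t (Suc n))" for n
      using inc sI by (simp add: t_def iso.ele_psi)
    have "is_esup (unit_interval C u) (\<phi> ` range t) (\<phi> a)"
    proof (subst V.is_esup_unit_interval)
      show "\<phi> ` range t \<subseteq> V.I" using sI t by auto
      show "\<phi> a \<in> V.I \<and> (\<forall>x\<in>\<phi> ` range t. cone_le C x (\<phi> a)) \<and>
        (\<forall>b\<in>V.I. (\<forall>x\<in>\<phi> ` range t. cone_le C x b) \<longrightarrow> cone_le C (\<phi> a) b)"
      proof (intro conjI ballI impI)
        \<comment> \<open>For an upper bound \<open>b\<close>, the difference
          \<open>\<phi> a - b\<close> is below every approximation error, hence below all dyadic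
          multiples of \<open>u\<close>; the Archimedean property makes it negative or zero.\<close>
        fix b assume "\<forall>x\<in>\<phi> ` range t. cone_le C x b"
        then have "cone_le C (s n) b" for n using t by auto
        then have "cone_le C (\<phi> a - b) (\<phi> a - s n)" for n by simp
        then have "cone_le C (\<phi> a - b) 0"
          using close V.le_trans by (intro V.le_zero_if_le_powers) blast
        then show "cone_le C (\<phi> a) b" by (simp add: cone_le_def)
      qed (use below assms(4) t in auto)
    qed
    then show "is_esup E (range t) a"
      using iso.iso_is_esup[of "range t" a] t assms(4) by auto
    show "(\<lambda>n. order_unit_norm C u (\<phi> (t n) - \<phi> a)) \<longlonglongrightarrow> 0"
    proof (rule tendsto_sandwich[OF always_eventually always_eventually tendsto_const])
      show "(\<lambda>n. (1 / 2) ^ n :: real) \<longlonglongrightarrow> 0"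
        by (rule LIMSEQ_realpow_zero) auto
      have "0 \<le> order_unit_norm C u (\<phi> (t n) - \<phi> a) \<and>
          order_unit_norm C u (\<phi> (t n) - \<phi> a) \<le> (1 / 2) ^ n" for n
      proof -
        let ?r = "(1 / 2) ^ n :: real"
        \<comment> \<open>The difference lies between \<open>- (?r *\<^sub>R u)\<close> and
          \<open>0\<close>, since the approximation is from below.\<close>
        have "cone_le C (- (?r *\<^sub>R u)) (s n - \<phi> a)"
          using close[of n] by (simp add: cone_le_def algebra_simps)
        moreover have "cone_le C (s n - \<phi> a) 0"
          using below[of n] by (simp add: cone_le_def)
        then have "cone_le C (s n - \<phi> a) (?r *\<^sub>R u)"
          by (rule V.le_trans) (simp add: V.scale_nonneg V.u_nonneg)
        ultimately show ?thesis
          using V.order_unit_norm_bounds[of ?r "s n - \<phi> a"] by (simp add: t)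
      qed
      then show "\<forall>n. 0 \<le> order_unit_norm C u (\<phi> (t n) - \<phi> a)"
        and "\<forall>n. order_unit_norm C u (\<phi> (t n) - \<phi> a) \<le> (1 / 2) ^ n"
        by blast+
    qed
    fix n
    obtain xs where xs: "\<And>l q. (l, q) \<in> set xs \<Longrightarrow> 0 < l \<and> l \<le> 1 \<and> q \<in> V.I \<and>
        sharp (unit_interval C u) q \<and> V.comm q (\<phi> a)"
      and orth: "sorted_wrt (\<lambda>x y. ?sq (snd x) (snd y) = 0) xs"
      and sum: "esum_list (unit_interval C u) (map (\<lambda>(l, q). l *\<^sub>R q) xs) = Some (s n)"
      using simple[of n] by fast
    define l where "l i = fst (xs ! i)" for i
    define p where "p i = iso.\<psi> (snd (xs ! i))" for i
    have lp: "0 < l i" "l i \<le> 1" "p i \<in> effects E" "\<phi> (p i) = snd (xs ! i)"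
      "sharp (unit_interval C u) (\<phi> (p i))" "V.comm (\<phi> (p i)) (\<phi> a)" if "i < length xs" for i
      using that xs[of "fst (xs ! i)" "snd (xs ! i)"] by (auto simp: l_def p_def)
    have sharp_p: "sharp E (p i)" if "i < length xs" for i
      using lp(5)[OF that] iso.iso_sharp[OF lp(3)[OF that]] by simp
    have comm: "commutes seqprod (p i) a" if "i < length xs" for i
      using lp(3,6)[OF that] assms(4) seq_V
      by (simp add: V.comm_def commutes_def iso.phi_eq_iff)
    have orth': "orthogonal_effects E seqprod (p i) (p j)" if "i < j" "j < length xs" for i j
    proof -
      have "?sq (snd (xs ! i)) (snd (xs ! j)) = 0"
        using sorted_wrt_nth_less[OF orth that] .
      then have "\<phi> (seqprod (p i) (p j)) = \<phi> \<zero>\<^bsub>E\<^esub>"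
        by (simp add: p_def iso.iso_zero)
      then show ?thesis
        using lp(3) that seq_V S.zero_closed by (simp add: orthogonal_effects_def iso.phi_eq_iff)
    qed
    \<comment> \<open>The list order gives orthogonality only for \<open>i < j\<close>; the symmetry
      axiom for zero products gives the other half.\<close>
    have orth_sym: "orthogonal_effects E seqprod (p i) (p j)"
      if "i < length xs" "j < length xs" "i \<noteq> j" for i j
    proof (cases "i < j")
      case True
      then show ?thesis using orth' that by blast
    next
      case False
      then have "orthogonal_effects E seqprod (p j) (p i)" using orth' that by simp
      then show ?thesis
        unfolding orthogonal_effects_def using S.seq_zero_sym lp(3) that by blast
    qed
    let ?ys = "map (\<lambda>i. smul (l i) (p i)) [0..<length xs]"
    have ys: "set ?ys \<subseteq> effects E"
      using lp(1-3) by (auto intro!: S.scale_closed simp: less_imp_le)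
    have "map \<phi> ?ys = map (\<lambda>(l, q). l *\<^sub>R q) xs"
    proof (rule nth_equalityI)
      fix i assume "i < length (map \<phi> ?ys)"
      then have i: "i < length xs" by simp
      have "\<phi> (smul (l i) (p i)) = l i *\<^sub>R \<phi> (p i)"
        using lp(1-3)[OF i] by (simp add: smul)
      then show "map \<phi> ?ys ! i = map (\<lambda>(l, q). l *\<^sub>R q) xs ! i"
        using i lp(4)[OF i] by (simp add: l_def case_prod_unfold)
    qed simp
    \<comment> \<open>The sum is defined on the interval, so it is defined in \<open>E\<close>;
      injectivity of \<open>\<phi>\<close> identifies its value with \<open>t n\<close>.\<close>
    then have "map_option \<phi> (esum_list E ?ys) = Some (s n)" "set_option (esum_list E ?ys) \<subseteq> effects E"
      using iso.iso_esum_list[OF ys] sum by simp_all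
    then obtain z where z: "esum_list E ?ys = Some z" "\<phi> z = s n" "z \<in> effects E"
      by auto
    then have "esum_list E ?ys = Some (t n)"
      using iso.psi_phi[of z] by (simp add: t_def)
    then show "\<exists>(k::nat) (l :: nat \<Rightarrow> real) (p :: nat \<Rightarrow> 'e).
       (\<forall>i<k. 0 < l i \<and> l i \<le> 1 \<and> sharp E (p i) \<and> commutes seqprod (p i) a) \<and>
       (\<forall>i<k. \<forall>j<k. i \<noteq> j \<longrightarrow> orthogonal_effects E seqprod (p i) (p j)) \<and>
       esum_list E (map (\<lambda>i. smul (l i) (p i)) [0..<k]) = Some (t n)"
      using lp(1,2) sharp_p comm orth_sym
      by (intro exI[of _ "length xs"] exI[of _ l] exI[of _ p]) simp
  qed
qed

end
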